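(* Let $p$ be an odd prime and let $n=2^\nu p^r n'$, where $\nu>0$ and $r\geq 0$ are integers and $n'$ is an odd positive integer with $p\nmid n'$. Let $l$ be a positive integer. Then the number $NH(p^{2l},n)$ of Hermitian self-dual negacyclic codes of length $n$ over $\mathbb{F}_{p^{2l}}$ is \[ NH(p^{2l},n)=\begin{cases}(p^r+1)^{\frac{1}{2}\sum_{d\mid n'}\frac{\phi(d2^{\nu+1})}{\operatorname{ord}_{d2^{\nu+1}}(p^{2l})}} & \text{if } 2^{\nu+1}\nmid (p^l+1),\\ 0 & \text{otherwise.}\end{cases} \]
   Context: A linear code of length $n$ over $\mathbb{F}_{p^{2l}}$ is an $\mathbb{F}_{p^{2l}}$-subspace of $\mathbb{F}_{p^{2l}}^n$. It is negacyclic if $(-c_{n-1},c_0,\dots,c_{n-2})\in C$ whenever $(c_0,\dots,c_{n-1})\in C$. The Hermitian dual of $C$ is $C^{\perp_H}=\{v\in\mathbb{F}_{p^{2l}}^n : \sum_{i=1}^n v_ic_i^{p^l}=0 \text{ for all } c\in C\}$, and $C$ is Hermitian self-dual if $C=C^{\perp_H}$. $\phi$ is Euler's totient function and $\operatorname{ord}_m(x)$ is the multiplicative order of $x$ modulo $m$. *)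

theory Defs
  imports "HOL-Number_Theory.Number_Theory"
begin

definition words :: "nat \<Rightarrow> 'a list set" where
  "words n = {v. length v = n}"

definition linear_code :: "nat \<Rightarrow> 'a::field list set \<Rightarrow> bool" where
  "linear_code n C \<longleftrightarrow> C \<subseteq> words n \<and> replicate n 0 \<in> C
     \<and> (\<forall>u\<in>C. \<forall>v\<in>C. map2 (+) u v \<in> C)
     \<and> (\<forall>a. \<forall>u\<in>C. map (\<lambda>x. a * x) u \<in> C)"

definition negacyclic :: "'a::field list set \<Rightarrow> bool" where
  "negacyclic C \<longleftrightarrow> (\<forall>c\<in>C. (- last c) # butlast c \<in> C)"

text \<open>Hermitian dual over F_{q^2}, where q = p^l: pairing sum v_i * c_i^q.\<close>
definition herm_dual :: "nat \<Rightarrow> nat \<Rightarrow> 'a::field list set \<Rightarrow> 'a list set" where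
  "herm_dual q n C = {v \<in> words n. \<forall>c\<in>C. (\<Sum>i<n. v ! i * (c ! i) ^ q) = 0}"

definition herm_self_dual :: "nat \<Rightarrow> nat \<Rightarrow> 'a::field list set \<Rightarrow> bool" where
  "herm_self_dual q n C \<longleftrightarrow> C = herm_dual q n C"

text \<open>Number of Hermitian self-dual negacyclic codes of length n over the finite
  field 'a, where the field has q^2 elements.\<close>
definition NH :: "'a::{field,finite} itself \<Rightarrow> nat \<Rightarrow> nat \<Rightarrow> nat" where
  "NH _ q n = card {C :: 'a list set. linear_code n C \<and> negacyclic C \<and> herm_self_dual q n C}"

end

theory Submission
  imports "HOL-Algebra.Algebraic_Closure_Type" Defs
begin

text \<open>
  Put \<open>q = p ^ l\<close>, \<open>m = 2 ^ \<nu> * n'\<close> and \<open>P = p ^ r\<close>, so that \<open>x ^ n + 1 = (x ^ m + 1) ^ P\<close>.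
  A negacyclic code is generated by a monic divisor \<open>g\<close> of \<open>x ^ n + 1\<close>, and it is Hermitian
  self-dual iff \<open>g\<close> times its conjugate reciprocal is a scalar multiple of \<open>x ^ n + 1\<close>.
  Over the algebraic closure such a \<open>g\<close> is given by its multiplicities \<open>e\<close> on the set \<open>S\<close> of
  roots of \<open>x ^ m + 1\<close>, and the condition becomes \<open>e b + e (\<sigma> b) = P\<close> for \<open>\<sigma> b = inverse b ^ q\<close>.
  As \<open>\<sigma>\<close> squared is the Frobenius map of the base field, this equation already makes \<open>e\<close> Frobenius
  invariant, i.e. \<open>g\<close> has coefficients in the base field. Since \<open>P\<close> is odd, an orbit of \<open>\<sigma>\<close> of odd
  length admits no such \<open>e\<close>, while one of even length admits \<open>P + 1\<close>. An odd orbit exists iff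
  \<open>2 ^ (\<nu> + 1) dvd q + 1\<close>; otherwise the orbit of a root of order \<open>N\<close> has length
  \<open>2 * ord N (q ^ 2)\<close>.
\<close>

section \<open>Polynomials under field homomorphisms and root multiplicities\<close>

locale field_hom =
  fixes h :: "'a::field \<Rightarrow> 'b::field"
  assumes hom_one: "h 1 = 1"
    and hom_add: "h (x + y) = h x + h y"
    and hom_mult: "h (x * y) = h x * h y"
begin

lemma hom_zero: "h 0 = 0"
  using hom_add[of 0 0] by (metis add.right_neutral add_left_cancel)

lemma hom_uminus: "h (- x) = - h x"
  using hom_add[of x "- x"] by (simp add: hom_zero minus_unique)

lemma hom_sum: "h (sum f A) = (\<Sum>x\<in>A. h (f x))"
  by (induction A rule: infinite_finite_induct) (auto simp: hom_zero hom_add)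

lemma hom_eq_0_iff: "h x = 0 \<longleftrightarrow> x = 0"
proof
  assume "h x = 0"
  then have "x \<noteq> 0 \<Longrightarrow> h (x * inverse x) = 0"
    by (simp only: hom_mult mult_zero_left)
  then show "x = 0"
    using hom_one by auto
qed (simp add: hom_zero)

lemma hom_eq_iff: "h x = h y \<longleftrightarrow> x = y"
  using hom_eq_0_iff[of "x - y"] hom_add[of x "- y"] by (simp add: hom_uminus)

lemma coeff_hom: "coeff (map_poly h f) i = h (coeff f i)"
  by (simp add: coeff_map_poly hom_zero)

lemma map_poly_add: "map_poly h (f + g) = map_poly h f + map_poly h g"
  by (rule poly_eqI) (simp add: coeff_hom hom_add)

lemma map_poly_mult: "map_poly h (f * g) = map_poly h f * map_poly h g"
  by (rule poly_eqI) (simp add: coeff_hom coeff_mult hom_sum hom_mult)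

lemma map_poly_power: "map_poly h (f ^ k) = map_poly h f ^ k"
  by (induction k) (simp_all add: map_poly_mult hom_one)

lemma map_poly_prod: "map_poly h (prod f A) = (\<Prod>x\<in>A. map_poly h (f x))"
  by (induction A rule: infinite_finite_induct) (auto simp: map_poly_mult hom_one)

lemma map_poly_hom_eq_iff: "map_poly h f = map_poly h g \<longleftrightarrow> f = g"
  by (simp add: poly_eq_iff coeff_hom hom_eq_iff)

lemma map_poly_hom_eq_0_iff: "map_poly h f = 0 \<longleftrightarrow> f = 0"
  by (simp add: poly_eq_iff coeff_hom hom_eq_0_iff)

lemma degree_hom: "degree (map_poly h f) = degree f"
  by (intro degree_map_poly) (simp add: hom_eq_0_iff)

lemma map_poly_linear: "map_poly h [:a, b:] = [:h a, h b:]"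
  by (simp add: map_poly_pCons hom_zero)

lemma map_poly_reflect: "map_poly h (reflect_poly f) = reflect_poly (map_poly h f)"
  by (rule poly_eqI) (simp add: coeff_hom coeff_reflect_poly degree_hom hom_zero)

lemma poly_map_poly_hom: "poly (map_poly h f) (h x) = h (poly f x)"
  by (induction f) (simp_all add: map_poly_pCons hom_zero hom_add hom_mult)

text \<open>A field homomorphism is injective, so the cofactor of \<open>f\<close> that is nonzero
  at \<open>a\<close> stays nonzero at \<open>h a\<close>.\<close>

lemma order_map_poly:
  assumes "f \<noteq> 0"
  shows "order (h a) (map_poly h f) = order a f"
proof -
  obtain u where u: "f = [:- a, 1:] ^ order a f * u" "\<not> [:- a, 1:] dvd u"
    using order_decomp[OF assms] by blast
  have "poly (map_poly h u) (h a) \<noteq> 0"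
    using u(2) by (simp add: poly_map_poly_hom hom_eq_0_iff poly_eq_0_iff_dvd)
  then have "order (h a) (map_poly h u) = 0"
    by (rule order_0I)
  moreover have "map_poly h f = [:- h a, 1:] ^ order a f * map_poly h u"
    by (subst u(1)) (simp add: map_poly_mult map_poly_power map_poly_linear hom_uminus hom_one)
  moreover have "map_poly h f \<noteq> 0"
    using assms by (simp add: map_poly_hom_eq_0_iff)
  ultimately show ?thesis
    by (simp add: order_mult order_power_n_n)
qed

end

text \<open>Reflection is multiplicative and turns \<open>x - a\<close> into a scalar multiple of
  \<open>x - inverse a\<close>. The condition \<open>a \<noteq> 0\<close> matters, as reflection
  discards factors \<open>x\<close>.\<close>

lemma order_reflect_poly:
  fixes f :: "'a::field poly"
  assumes "f \<noteq> 0" "a \<noteq> 0"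
  shows "order (inverse a) (reflect_poly f) = order a f"
proof -
  define k where "k = order a f"
  obtain u where u: "f = [:- a, 1:] ^ k * u" "\<not> [:- a, 1:] dvd u"
    using order_decomp[OF assms(1)] unfolding k_def by blast
  have "poly (reflect_poly u) (inverse a) \<noteq> 0"
    using u(2) assms(2) by (simp add: poly_reflect_poly_nz poly_eq_0_iff_dvd)
  then have "order (inverse a) (reflect_poly u) = 0"
    by (rule order_0I)
  moreover have "reflect_poly [:- a, 1:] = smult (- a) [:- inverse a, 1:]"
    using assms(2) by (simp add: reflect_poly_pCons)
  then have "reflect_poly f = smult ((- a) ^ k) ([:- inverse a, 1:] ^ k * reflect_poly u)"
    by (subst u(1)) (simp only: reflect_poly_mult reflect_poly_power smult_power mult_smult_left)
  moreover have "u \<noteq> 0"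
    using u(2) by auto
  then have "[:- inverse a, 1:] ^ k * reflect_poly u \<noteq> 0"
    by simp
  ultimately show ?thesis
    using assms(2) unfolding k_def[symmetric]
    by (simp add: order_mult order_power_n_n order_smult)
qed

section \<open>Reconstruction of a polynomial from its root multiplicities\<close>

lemma order_linear_factor:
  fixes a b :: "'a::field"
  shows "order b ([:- a, 1:] ^ k) = (if a = b then k else 0)"
proof (cases "a = b")
  case False
  then have "poly ([:- a, 1:] ^ k) b \<noteq> 0"
    by simp
  then show ?thesis
    using False by (simp add: order_0I)
qed (simp add: order_power_n_n)

lemma order_prod_linear_factors:
  fixes S :: "'a::field set"
  assumes "finite S"
  shows "order b (\<Prod>a\<in>S. [:- a, 1:] ^ e a) = (if b \<in> S then e b else 0)"
  using assms
proof (induction S)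
  case (insert a S)
  have "(\<Prod>x\<in>insert a S. [:- x, 1:] ^ e x) \<noteq> 0"
    using insert.hyps by (simp del: prod.insert)
  then have "order b (\<Prod>x\<in>insert a S. [:- x, 1:] ^ e x) =
      order b ([:- a, 1:] ^ e a) + order b (\<Prod>x\<in>S. [:- x, 1:] ^ e x)"
    using insert.hyps by (simp only: prod.insert order_mult not_False_eq_True)
  then show ?case
    using insert by (auto simp: order_linear_factor)
qed simp

text \<open>Induction on the degree of \<open>f\<close>: a root of \<open>f\<close> is also a root
  of \<open>g\<close>, and removing the common linear factor lowers both multiplicities
  alike.\<close>

lemma alg_closed_dvdI:
  fixes f g :: "'a::alg_closed_field poly"
  assumes "f \<noteq> 0" "g \<noteq> 0" "\<And>x. order x f \<le> order x g"
  shows "f dvd g"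
  using assms
proof (induction "degree f" arbitrary: f g)
  case 0
  then show ?case
    using is_unit_iff_degree[of f] unit_imp_dvd[of f g] by simp
next
  case (Suc d)
  then obtain a where a: "poly f a = 0"
    using alg_closed_imp_poly_has_root[of f] by auto
  then have "order a f \<noteq> 0"
    using Suc.prems(1) order_root by blast
  then have "poly g a = 0"
    using Suc.prems(3)[of a] by (simp add: order_root)
  then obtain f' g' where fg: "f = [:- a, 1:] * f'" "g = [:- a, 1:] * g'"
    using a by (metis poly_eq_0_iff_dvd dvd_def)
  have nz: "f' \<noteq> 0" "g' \<noteq> 0"
    using fg Suc.prems by auto
  have "order x f' \<le> order x g'" for x
    using Suc.prems(3)[of x] order_mult[of "[:- a, 1:]" f' x] order_mult[of "[:- a, 1:]" g' x]
      Suc.prems(1,2) unfolding fg by linarith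
  moreover have "degree f = Suc (degree f')"
    unfolding fg by (subst degree_mult_eq) (use nz in auto)
  ultimately have "f' dvd g'"
    using Suc.hyps nz by auto
  then show ?case
    unfolding fg by (rule mult_dvd_mono[OF dvd_refl])
qed

text \<open>Associated polynomials differ by a constant. Scaling crosswise by the leading
  coefficients names that constant without division and includes the zero polynomial.\<close>

lemma dvd_antisym_lead_coeff:
  fixes f g :: "'a::field poly"
  assumes "f dvd g" "g dvd f"
  shows "smult (lead_coeff g) f = smult (lead_coeff f) g"
proof (cases "f = 0")
  case False
  obtain u where u: "g = f * u"
    using assms(1) by (auto simp: dvd_def)
  then have nz: "g \<noteq> 0" "u \<noteq> 0"
    using assms(2) False by auto
  then have "degree f + degree u \<le> degree f"
    using dvd_imp_degree_le[OF assms(2) False] u False by (simp add: degree_mult_eq)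
  then obtain c where "u = [:c:]"
    by (auto elim: degree_eq_zeroE)
  then show ?thesis
    using u by (simp add: lead_coeff_smult mult.commute)
qed (use assms in simp)

lemma alg_closed_eqI:
  fixes f g :: "'a::alg_closed_field poly"
  assumes "f \<noteq> 0" "g \<noteq> 0" "\<And>x. order x f = order x g"
  shows "smult (lead_coeff g) f = smult (lead_coeff f) g"
  using assms by (intro dvd_antisym_lead_coeff alg_closed_dvdI) auto

section \<open>Negacyclic codes and their generators\<close>

text \<open>When \<open>g\<close> divides \<open>x ^ n + 1\<close>, this is the ideal generated by
  \<open>g\<close> in the quotient ring, written as coefficient lists.\<close>

definition code_of :: "nat \<Rightarrow> 'a::field poly \<Rightarrow> 'a list set" where
  "code_of n g = {v \<in> words n. g dvd Poly v}"

text \<open>The conjugate reciprocal polynomial, not rescaled to be monic; hence the free constant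
  \<open>c\<close> in the factorisations below.\<close>

definition conj_recip :: "nat \<Rightarrow> 'a::field poly \<Rightarrow> 'a poly" where
  "conj_recip q g = reflect_poly (map_poly (\<lambda>x. x ^ q) g)"

text \<open>The quotient map onto \<open>F[x] / (x ^ n + 1)\<close>, with residues represented by
  words. It allows ideals to be handled in the polynomial ring itself.\<close>

definition word_of :: "nat \<Rightarrow> 'a::field poly \<Rightarrow> 'a list" where
  "word_of n f = map (coeff (f mod (monom 1 n + 1))) [0..<n]"

section \<open>Words as polynomials modulo \<open>x ^ n + 1\<close>\<close>

lemma coeff_Poly_words: "v \<in> words n \<Longrightarrow> coeff (Poly v) i = (if i < n then v ! i else 0)"
  by (simp add: words_def nth_default_def)

lemma Poly_words_inj: "u \<in> words n \<Longrightarrow> v \<in> words n \<Longrightarrow> Poly u = Poly v \<Longrightarrow> u = v"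
  by (rule nth_equalityI) (auto simp: words_def poly_eq_iff coeff_Poly_words nth_default_def split: if_splits)

lemma degree_Poly_words: "v \<in> words n \<Longrightarrow> n > 0 \<Longrightarrow> degree (Poly v) < n"
  by (rule degree_lessI) (auto simp: coeff_Poly_words simp del: coeff_Poly_eq)

lemma Poly_map2_add: "u \<in> words n \<Longrightarrow> v \<in> words n \<Longrightarrow> Poly (map2 (+) u v) = Poly u + Poly v"
  by (rule poly_eqI) (auto simp: words_def nth_default_def)

lemma Poly_map_mult: "Poly (map ((*) a) v) = smult a (Poly v)"
  for a :: "'a::field"
  by (rule poly_eqI) (auto simp: nth_default_def)

lemma degree_negacyclic_modulus:
  "n > 0 \<Longrightarrow> degree (monom 1 n + 1 :: 'a::field poly) = n"
  by (simp add: degree_add_eq_left degree_monom_eq)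

lemma coeff_negacyclic_modulus:
  "coeff (monom 1 n + 1 :: 'a::field poly) i = (if i = n then 1 else 0) + (if i = 0 then 1 else 0)"
  by auto

lemma negacyclic_modulus_nonzero [simp]: "n > 0 \<Longrightarrow> (monom 1 n + 1 :: 'a::field poly) \<noteq> 0"
  by (metis degree_negacyclic_modulus degree_0 less_not_refl)

lemma lead_coeff_negacyclic_modulus:
  "n > 0 \<Longrightarrow> lead_coeff (monom 1 n + 1 :: 'a::field poly) = 1"
  by (simp add: degree_negacyclic_modulus coeff_negacyclic_modulus del: coeff_add)

lemma reflect_poly_monom: "reflect_poly (monom 1 n :: 'a::field poly) = 1"
  by (rule poly_eqI) (auto simp: coeff_reflect_poly degree_monom_eq)

lemma reflect_negacyclic_modulus:
  assumes "n > 0"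
  shows "reflect_poly (monom 1 n + 1 :: 'a::field poly) = monom 1 n + 1"
  by (rule poly_eqI)
    (use assms in \<open>auto simp: coeff_reflect_poly degree_negacyclic_modulus coeff_negacyclic_modulus
      simp del: coeff_add\<close>)

lemma word_of_in_words: "word_of n f \<in> words n"
  by (simp add: word_of_def words_def)

lemma Poly_word_of:
  assumes "n > 0"
  shows "Poly (word_of n f) = f mod (monom 1 n + 1)"
proof (rule poly_eqI)
  fix i
  have "degree (f mod (monom 1 n + 1)) < n"
    using degree_mod_less'[of "monom 1 n + 1" f] assms
    by (cases "f mod (monom 1 n + 1) = 0") (auto simp: degree_negacyclic_modulus)
  then have "i \<ge> n \<Longrightarrow> coeff (f mod (monom 1 n + 1)) i = 0"
    by (simp add: coeff_eq_0)
  then show "coeff (Poly (word_of n f)) i = coeff (f mod (monom 1 n + 1)) i"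
    using coeff_Poly_words[OF word_of_in_words, of n f i] by (simp add: word_of_def)
qed

lemma word_of_Poly:
  assumes "v \<in> words n" "n > 0"
  shows "word_of n (Poly v) = v"
proof (rule Poly_words_inj[OF word_of_in_words assms(1)])
  show "Poly (word_of n (Poly v)) = Poly v"
    using assms by (simp add: Poly_word_of mod_poly_less degree_Poly_words degree_negacyclic_modulus)
qed

lemma word_of_code_of_iff:
  assumes "n > 0" "g dvd monom 1 n + 1"
  shows "word_of n f \<in> code_of n g \<longleftrightarrow> g dvd f"
  using assms by (simp add: code_of_def word_of_in_words Poly_word_of dvd_mod_iff)

text \<open>The shift is multiplication by \<open>x\<close> modulo \<open>x ^ n + 1\<close>: the
  overflowing term \<open>last c * x ^ n\<close> returns as the constant
  \<open>- last c\<close>.\<close>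

lemma Poly_negacyclic_shift:
  fixes c :: "'a::field list"
  assumes "c \<in> words n" "n > 0"
  shows "Poly (- last c # butlast c) = pCons 0 (Poly c) - smult (last c) (monom 1 n + 1)"
proof (rule poly_eqI)
  fix i
  have "length c = n" "c \<noteq> []"
    using assms by (auto simp: words_def)
  then show "coeff (Poly (- last c # butlast c)) i =
      coeff (pCons 0 (Poly c) - smult (last c) (monom 1 n + 1)) i"
    using assms
    by (cases i) (auto simp: nth_default_def nth_butlast last_conv_nth coeff_pCons)
qed

lemma negacyclic_shift_in_words: "c \<in> words n \<Longrightarrow> n > 0 \<Longrightarrow> - last c # butlast c \<in> words n"
  by (auto simp: words_def)

section \<open>Negacyclic codes as ideals\<close>

lemma linear_code_code_of: "linear_code n (code_of n g)"
proof -
  have "map2 (+) u v \<in> code_of n g" if "u \<in> code_of n g" "v \<in> code_of n g" for u v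
    using that Poly_map2_add[of u n v] by (auto simp: code_of_def words_def)
  moreover have "map (\<lambda>x. a * x) u \<in> code_of n g" if "u \<in> code_of n g" for a u
    using that Poly_map_mult[of a u] by (auto simp: code_of_def words_def dvd_smult)
  moreover have "replicate n 0 \<in> code_of n g"
    by (simp add: code_of_def words_def Poly_replicate_0)
  ultimately show ?thesis
    unfolding linear_code_def by (auto simp: code_of_def)
qed

lemma negacyclic_code_of:
  assumes "n > 0" "g dvd monom 1 n + 1"
  shows "negacyclic (code_of n g)"
  unfolding negacyclic_def
proof
  fix c assume c: "c \<in> code_of n g"
  then have "g dvd [:0, 1:] * Poly c - smult (last c) (monom 1 n + 1)"
    using assms(2) by (intro dvd_diff dvd_mult dvd_smult) (auto simp: code_of_def)
  then show "- last c # butlast c \<in> code_of n g"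
    using c Poly_negacyclic_shift[of c n] negacyclic_shift_in_words[of c n] assms
    by (simp add: code_of_def)
qed

lemma word_of_cong: "n > 0 \<Longrightarrow> monom 1 n + 1 dvd f - g \<Longrightarrow> word_of n f = word_of n g"
  using mod_eq_dvd_iff[of f "monom 1 n + 1" g] by (simp add: word_of_def)

text \<open>The preimage \<open>I\<close> of the code under \<open>word_of n\<close> is an ideal
  containing the modulus. A monic element of least degree generates it, by division with
  remainder.\<close>

lemma negacyclic_code_generator:
  fixes C :: "'a::field list set"
  assumes n: "n > 0" and C: "linear_code n C" "negacyclic C"
  obtains g where "lead_coeff g = 1" "g dvd monom 1 n + 1" "C = code_of n g"
proof -
  define M :: "'a poly" where "M = monom 1 n + 1"
  define I where "I = {f. word_of n f \<in> C}"
  have M: "M \<noteq> 0"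
    using n by (simp add: M_def)
  have add: "f + g \<in> I" if "f \<in> I" "g \<in> I" for f g
  proof -
    have "word_of n (f + g) = map2 (+) (word_of n f) (word_of n g)"
      by (rule nth_equalityI) (auto simp: word_of_def poly_mod_add_left)
    then show ?thesis
      using that C(1) by (auto simp: I_def linear_code_def)
  qed
  have smult: "smult a f \<in> I" if "f \<in> I" for a f
  proof -
    have "word_of n (smult a f) = map (\<lambda>x. a * x) (word_of n f)"
      by (rule nth_equalityI) (auto simp: word_of_def mod_smult_left)
    then show ?thesis
      using that C(1) by (auto simp: I_def linear_code_def)
  qed
  have shift: "pCons 0 f \<in> I" if "f \<in> I" for f
  proof -
    let ?c = "word_of n f"
    have c: "?c \<in> words n"
      by (rule word_of_in_words)
    \<comment> \<open>\<open>f\<close> may have large degree; it differs from its remainder by a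
      multiple of \<open>M\<close>, so \<open>x * f\<close> still reduces to the shifted
      word.\<close>
    have "pCons 0 f - Poly (- last ?c # butlast ?c) =
        [:0, 1:] * (f - f mod M) + smult (last ?c) M"
      unfolding Poly_negacyclic_shift[OF c n] Poly_word_of[OF n] M_def[symmetric]
      by (simp add: algebra_simps)
    also have "M dvd \<dots>"
      by (intro dvd_add dvd_mult dvd_smult) (auto simp: minus_mod_eq_mult_div)
    finally have "word_of n (pCons 0 f) = word_of n (Poly (- last ?c # butlast ?c))"
      unfolding M_def by (rule word_of_cong[OF n])
    also have "\<dots> = - last ?c # butlast ?c"
      by (rule word_of_Poly[OF negacyclic_shift_in_words[OF c n] n])
    finally show ?thesis
      using that C(2) by (simp add: I_def negacyclic_def)
  qed
  \<comment> \<open>Linearity and closure under multiplication by \<open>x\<close> give closure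
    under every polynomial factor, by Horner recursion.\<close>
  have mult: "u * f \<in> I" if "f \<in> I" for u f
  proof (induction u)
    case 0
    then show ?case
      using smult[OF that, of 0] by simp
  next
    case (pCons a u)
    then show ?case
      using add[OF smult[OF that, of a] shift] by simp
  qed
  have M_in: "M \<in> I"
  proof -
    have "word_of n M = replicate n 0"
      by (rule nth_equalityI) (auto simp: word_of_def M_def)
    then show ?thesis
      using C(1) by (simp add: I_def linear_code_def)
  qed
  define d where "d = (LEAST d. \<exists>f\<in>I. f \<noteq> 0 \<and> degree f = d)"
  have "\<exists>f\<in>I. f \<noteq> 0 \<and> degree f = d"
    unfolding d_def by (rule LeastI_ex) (use M_in M in blast)
  then obtain f0 where f0: "f0 \<in> I" "f0 \<noteq> 0" "degree f0 = d"
    by blast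
  define g where "g = smult (inverse (lead_coeff f0)) f0"
  have g: "g \<in> I" "lead_coeff g = 1" "degree g = d"
    using f0 smult by (auto simp: g_def)
  have gen: "g dvd f" if "f \<in> I" for f
  proof (rule ccontr)
    assume "\<not> g dvd f"
    then have nz: "f mod g \<noteq> 0"
      by (simp add: mod_eq_0_iff_dvd)
    have "f mod g = f + (- (f div g)) * g"
      by (simp add: minus_div_mult_eq_mod[symmetric])
    then have "f mod g \<in> I"
      using add[OF that mult[OF g(1), of "- (f div g)"]] by simp
    then have "d \<le> degree (f mod g)"
      unfolding d_def using nz by (intro Least_le) blast
    moreover have "degree (f mod g) < degree g"
      using nz g(2) by (intro degree_mod_less') auto
    ultimately show False
      using g(3) by simp
  qed
  have gM: "g dvd M"
    using gen M_in by blast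
  have "f \<in> I \<longleftrightarrow> g dvd f" for f
    using gen[of f] mult[OF g(1)] by (auto simp: dvd_def mult.commute)
  then have "word_of n f \<in> C \<longleftrightarrow> word_of n f \<in> code_of n g" for f
    using word_of_code_of_iff[OF n gM[unfolded M_def], of f] by (simp add: I_def)
  then have "v \<in> C \<longleftrightarrow> v \<in> code_of n g" if "v \<in> words n" for v
  proof -
    from \<open>\<And>f. word_of n f \<in> C \<longleftrightarrow> word_of n f \<in> code_of n g\<close>[of "Poly v"]
    show ?thesis
      by (simp only: word_of_Poly[OF that n])
  qed
  moreover have "C \<subseteq> words n" "code_of n g \<subseteq> words n"
    using C(1) by (auto simp: linear_code_def code_of_def)
  ultimately have "C = code_of n g"
    by blast
  then show thesis
    using that g(2) gM by (simp add: M_def)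
qed

lemma code_of_inj:
  assumes "n > 0" "g dvd monom 1 n + 1" "h dvd monom 1 n + 1" "code_of n g = code_of n h"
    and "lead_coeff g = 1" "lead_coeff h = 1"
  shows "g = h"
proof -
  have eq: "g dvd f \<longleftrightarrow> h dvd f" for f
    using word_of_code_of_iff[OF assms(1,2), of f] word_of_code_of_iff[OF assms(1,3), of f] assms(4)
    by simp
  have "g dvd h" "h dvd g"
    using eq[of h] eq[of g] by simp_all
  then show ?thesis
    using dvd_antisym_lead_coeff[of g h] assms(5,6) by simp
qed

section \<open>Hermitian duality expressed by divisibility\<close>

text \<open>Reversing the conjugated word makes the convolution at index \<open>n - 1\<close> pair
  equal positions. Reflection reverses at the degree of \<open>Poly u\<close> rather than at
  \<open>n - 1\<close>; the monomial makes up the difference.\<close>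

lemma hermitian_form_eq_coeff:
  fixes u v :: "'a::field list"
  assumes hom: "field_hom (\<lambda>x::'a. x ^ q)" and n: "n > 0" and v: "v \<in> words n" and u: "u \<in> words n"
  shows "(\<Sum>i<n. v ! i * (u ! i) ^ q) =
    coeff (Poly v * (monom 1 (n - 1 - degree (Poly u)) * conj_recip q (Poly u))) (n - 1)"
proof -
  interpret field_hom "\<lambda>x::'a. x ^ q"
    by (rule hom)
  define d where "d = degree (Poly u)"
  have d: "d < n"
    unfolding d_def by (rule degree_Poly_words[OF u n])
  have R: "coeff (monom 1 (n - 1 - d) * conj_recip q (Poly u)) (n - 1 - i) = (u ! i) ^ q" if "i < n" for i
  proof (cases "i \<le> d")
    case True
    then have "n - 1 - i - (n - 1 - d) = d - i" "\<not> n - 1 - i < n - 1 - d"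
      using d by auto
    then show ?thesis
      using True that unfolding conj_recip_def
      by (auto simp: coeff_monom_mult coeff_reflect_poly degree_hom coeff_hom coeff_Poly_words[OF u]
          d_def[symmetric] simp del: coeff_Poly_eq)
  next
    case False
    then have "coeff (Poly u) i = 0"
      by (intro coeff_eq_0) (simp add: d_def)
    then have "u ! i = 0"
      using that by (simp add: coeff_Poly_words[OF u] del: coeff_Poly_eq)
    moreover have "n - 1 - i < n - 1 - d"
      using False that d by auto
    ultimately show ?thesis
      by (simp add: coeff_monom_mult hom_zero)
  qed
  have "{..n - 1} = {..<n}"
    using n by auto
  then show ?thesis
    unfolding coeff_mult[of "Poly v"] d_def[symmetric]
    by (intro sum.cong) (simp_all only: R lessThan_iff coeff_Poly_words[OF v] if_True)
qed

text \<open>Orthogonality is a statement about single coefficients. Testing against all shifts of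
  \<open>g\<close> kills a whole block of coefficients of \<open>Poly v * conj_recip q g\<close>,
  which is enough to force divisibility.\<close>

lemma herm_dual_code_of:
  fixes g :: "'a::field poly"
  assumes hom: "field_hom (\<lambda>x::'a. x ^ q)" and n: "n > 0" and g: "g dvd monom 1 n + 1"
    and v: "v \<in> words n"
  shows "v \<in> herm_dual q n (code_of n g) \<longleftrightarrow> monom 1 n + 1 dvd Poly v * conj_recip q g"
proof
  interpret field_hom "\<lambda>x::'a. x ^ q"
    by (rule hom)
  define M :: "'a poly" where "M = monom 1 n + 1"
  note dM = degree_negacyclic_modulus[OF n, where ?'a = 'a, folded M_def]
  have M: "M \<noteq> 0"
    using n by (simp add: M_def)
  have g0: "coeff g 0 \<noteq> 0" "g \<noteq> 0"
  proof -
    obtain k where "M = g * k"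
      using g by (auto simp: M_def dvd_def)
    then have "coeff g 0 * coeff k 0 = coeff M 0"
      by (simp add: coeff_mult)
    also have "coeff M 0 = 1"
      using n by (simp add: M_def)
    finally show "coeff g 0 \<noteq> 0"
      by auto
    then show "g \<noteq> 0"
      by auto
  qed
  {
    assume "monom 1 n + 1 dvd Poly v * conj_recip q g"
    then have dvd: "M dvd Poly v * conj_recip q g"
      by (simp add: M_def)
    have "(\<Sum>i<n. v ! i * (c ! i) ^ q) = 0" if c: "c \<in> code_of n g" for c
    proof -
      have cw: "c \<in> words n"
        using c by (simp add: code_of_def)
      obtain a where a: "Poly c = g * a"
        using c by (auto simp: code_of_def)
      define R where "R = monom 1 (n - 1 - degree (Poly c)) * conj_recip q (Poly c)"
      have "conj_recip q (Poly c) = conj_recip q g * conj_recip q a"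
        by (simp add: conj_recip_def a map_poly_mult reflect_poly_mult)
      then have "Poly v * R = (Poly v * conj_recip q g) * (monom 1 (n - 1 - degree (Poly c)) * conj_recip q a)"
        by (simp add: R_def mult_ac)
      then have "M dvd Poly v * R"
        using dvd by (simp only: dvd_mult2)
      then obtain u where u: "Poly v * R = M * u"
        by (elim dvdE)
      \<comment> \<open>The product has degree at most \<open>2 * n - 2\<close>, so \<open>u\<close>
        has degree below \<open>n - 1\<close>, and the other summand \<open>x ^ n * u\<close> of
        \<open>M * u\<close> starts only at index \<open>n\<close>.\<close>
      have "coeff (M * u) (n - 1) = 0"
      proof (cases "u = 0")
        case False
        have "degree R \<le> n - 1 - degree (Poly c) + degree (conj_recip q (Poly c))"
          unfolding R_def by (rule order_trans[OF degree_mult_le]) (simp add: degree_monom_eq)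
        also have "degree (conj_recip q (Poly c)) \<le> degree (Poly c)"
          unfolding conj_recip_def by (rule order_trans[OF degree_reflect_poly_le]) (simp add: degree_hom)
        finally have "degree R \<le> n - 1"
          using degree_Poly_words[OF cw n] by simp
        then have "degree (M * u) \<le> (n - 1) + (n - 1)"
          using degree_mult_le[of "Poly v" R] degree_Poly_words[OF v n] u by simp
        then have "degree u < n - 1"
          using M False n by (simp add: degree_mult_eq dM)
        then have "coeff u (n - 1) = 0"
          by (rule coeff_eq_0)
        then show ?thesis
          using n by (simp add: M_def distrib_right coeff_monom_mult)
      qed simp
      then show ?thesis
        using hermitian_form_eq_coeff[OF hom n v cw] u by (simp add: R_def)
    qed
    then show "v \<in> herm_dual q n (code_of n g)"
      using v by (simp add: herm_dual_def)
  next
    assume dual: "v \<in> herm_dual q n (code_of n g)"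
    define e where "e = degree g"
    define f where "f = Poly v * conj_recip q g"
    have e: "e \<le> n"
      using dvd_imp_degree_le[OF g[folded M_def] M] by (simp add: e_def dM)
    \<comment> \<open>The codeword \<open>x ^ (i - e) * g\<close> has degree exactly
      \<open>i\<close>, so pairing it with \<open>v\<close> reads off coefficient \<open>i\<close>
      of \<open>f\<close>.\<close>
    have vanish: "coeff f i = 0" if i: "e \<le> i" "i < n" for i
    proof -
      define j where "j = i - e"
      define c where "c = word_of n (monom 1 j * g)"
      have deg: "degree (monom 1 j * g) = i"
        using i g0 by (simp add: degree_mult_eq degree_monom_eq j_def e_def monom_eq_0_iff)
      then have Pc: "Poly c = monom 1 j * g"
        unfolding c_def Poly_word_of[OF n] using i by (intro mod_poly_less) (simp add: degree_negacyclic_modulus n)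
      have cw: "c \<in> words n"
        unfolding c_def by (rule word_of_in_words)
      have "c \<in> code_of n g"
        unfolding c_def by (simp add: word_of_code_of_iff[OF n g])
      then have "coeff (Poly v * (monom 1 (n - 1 - i) * conj_recip q (Poly c))) (n - 1) = 0"
        using dual hermitian_form_eq_coeff[OF hom n v cw] by (simp add: herm_dual_def Pc deg)
      moreover have "conj_recip q (Poly c) = conj_recip q g"
        unfolding conj_recip_def Pc
        by (simp add: map_poly_mult reflect_poly_mult map_poly_monom hom_zero reflect_poly_monom)
      ultimately have "coeff (monom 1 (n - 1 - i) * f) (n - 1) = 0"
        by (simp add: f_def mult_ac)
      moreover have "\<not> n - 1 < n - 1 - i" "n - 1 - (n - 1 - i) = i"
        using i by auto
      ultimately show ?thesis
        by (simp add: coeff_monom_mult)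
    qed
    \<comment> \<open>Modulo \<open>x ^ n + 1\<close> the product is \<open>A - B\<close>, whose degree is too small for a nonzero multiple
      of the conjugate reciprocal of \<open>g\<close>.\<close>
    define A where "A = poly_cutoff n f"
    define B where "B = poly_shift n f"
    have f: "f = A + monom 1 n * B"
      by (rule poly_eqI) (simp add: A_def B_def coeff_poly_cutoff coeff_poly_shift coeff_monom_mult)
    have deg_conj: "degree (conj_recip q g) = e"
      using g0 unfolding conj_recip_def e_def
      by (simp add: degree_hom coeff_hom hom_eq_0_iff)
    have "degree f < n + e"
      using degree_mult_le[of "Poly v" "conj_recip q g"] degree_Poly_words[OF v n] deg_conj
      by (simp add: f_def)
    then have small: "coeff (A - B) i = 0" if "i \<ge> e" for i
      using that vanish[of i] coeff_eq_0[of f "i + n"]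
      by (simp add: A_def B_def coeff_poly_cutoff coeff_poly_shift add.commute)
    \<comment> \<open>The modulus is its own conjugate reciprocal, so it is divisible by that of
      \<open>g\<close>; hence \<open>A - B\<close> is too.\<close>
    have "conj_recip q M = M"
      using reflect_negacyclic_modulus[OF n, where ?'a = 'a]
      by (simp add: conj_recip_def M_def map_poly_add map_poly_monom hom_zero hom_one)
    moreover have "conj_recip q g dvd conj_recip q M"
      using g unfolding M_def[symmetric] conj_recip_def
      by (auto simp: dvd_def map_poly_mult reflect_poly_mult)
    moreover have fAB: "f = (A - B) + M * B"
      by (subst f) (simp add: M_def algebra_simps)
    moreover have "conj_recip q g dvd f"
      by (simp add: f_def)
    ultimately have "conj_recip q g dvd f - M * B"
      by (intro dvd_diff dvd_mult2) simp_all
    then have "conj_recip q g dvd A - B"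
      by (subst (asm) fAB) simp
    then have "A - B \<noteq> 0 \<Longrightarrow> e \<le> degree (A - B)"
      using dvd_imp_degree_le deg_conj by blast
    then have "A - B = 0"
      using small[of "degree (A - B)"] leading_coeff_0_iff by blast
    then show "monom 1 n + 1 dvd Poly v * conj_recip q g"
      using fAB by (simp add: f_def M_def)
  }
qed

text \<open>Self-duality says that \<open>g dvd f\<close> iff
  \<open>M dvd f * conj_recip q g\<close>. Testing \<open>f = g\<close> and the conjugate reciprocal
  of the cofactor of \<open>g\<close> makes \<open>g * conj_recip q g\<close> and \<open>M\<close>
  divide each other. Conversely, cancel \<open>conj_recip q g\<close>.\<close>

lemma herm_self_dual_code_of_iff:
  fixes g :: "'a::field poly"
  assumes hom: "field_hom (\<lambda>x::'a. x ^ q)" and n: "n > 0" and g: "g dvd monom 1 n + 1"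
  shows "herm_self_dual q n (code_of n g) \<longleftrightarrow>
    (\<exists>c. c \<noteq> 0 \<and> g * conj_recip q g = smult c (monom 1 n + 1))"
proof
  interpret field_hom "\<lambda>x::'a. x ^ q"
    by (rule hom)
  define M :: "'a poly" where "M = monom 1 n + 1"
  have M: "M \<noteq> 0" "lead_coeff M = 1"
    using n lead_coeff_negacyclic_modulus[OF n, where ?'a = 'a] by (simp_all add: M_def)
  have dual: "word_of n f \<in> herm_dual q n (code_of n g) \<longleftrightarrow> M dvd f * conj_recip q g" for f
  proof -
    have "f * conj_recip q g = f mod M * conj_recip q g + M * (f div M * conj_recip q g)"
      by (subst mod_mult_div_eq[of f M, symmetric]) (simp only: distrib_right mult.assoc)
    then have "M dvd f * conj_recip q g \<longleftrightarrow> M dvd f mod M * conj_recip q g"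
      by (simp add: dvd_add_left_iff)
    then show ?thesis
      using herm_dual_code_of[OF hom n g word_of_in_words, of f] by (simp add: Poly_word_of[OF n] M_def)
  qed
  show "\<exists>c. c \<noteq> 0 \<and> g * conj_recip q g = smult c (monom 1 n + 1)"
    if "herm_self_dual q n (code_of n g)"
  proof -
    have eq: "g dvd f \<longleftrightarrow> M dvd f * conj_recip q g" for f
      using that dual[of f] word_of_code_of_iff[OF n g, of f] by (simp add: herm_self_dual_def)
    obtain h where h: "M = g * h"
      using g by (auto simp: M_def)
    have "conj_recip q M = M"
      using reflect_negacyclic_modulus[OF n, where ?'a = 'a]
      by (simp add: conj_recip_def M_def map_poly_add map_poly_monom hom_zero hom_one)
    then have M_eq: "M = conj_recip q h * conj_recip q g"
      by (simp add: h conj_recip_def map_poly_mult reflect_poly_mult mult.commute)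
    have "g dvd conj_recip q h"
      unfolding eq using M_eq by simp
    then have "g * conj_recip q g dvd M"
      by (subst M_eq) simp
    moreover have "M dvd g * conj_recip q g"
      using eq[of g] by simp
    ultimately have "g * conj_recip q g = smult (lead_coeff (g * conj_recip q g)) M"
      using dvd_antisym_lead_coeff[of "g * conj_recip q g" M] M(2) by simp
    moreover have "g * conj_recip q g \<noteq> 0"
      using \<open>g * conj_recip q g dvd M\<close> M(1) by auto
    ultimately show ?thesis
      unfolding M_def using leading_coeff_0_iff by blast
  qed
  show "herm_self_dual q n (code_of n g)"
    if "\<exists>c. c \<noteq> 0 \<and> g * conj_recip q g = smult c (monom 1 n + 1)"
  proof -
    from that obtain c where c: "c \<noteq> 0" "g * conj_recip q g = smult c M"
      by (auto simp: M_def)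
    then have nz: "conj_recip q g \<noteq> 0"
      using M(1) by auto
    have "M dvd f * conj_recip q g \<longleftrightarrow> g dvd f" for f
    proof -
      have "M dvd f * conj_recip q g \<longleftrightarrow> smult c M dvd f * conj_recip q g"
        using c(1) by (simp add: smult_dvd_iff)
      also have "\<dots> \<longleftrightarrow> g dvd f"
        unfolding c(2)[symmetric] using nz by simp
      finally show ?thesis .
    qed
    then have "v \<in> code_of n g \<longleftrightarrow> v \<in> herm_dual q n (code_of n g)" if "v \<in> words n" for v
      using dual[of "Poly v"] word_of_code_of_iff[OF n g, of "Poly v"] word_of_Poly[OF that n] by simp
    then show ?thesis
      unfolding herm_self_dual_def by (auto simp: code_of_def herm_dual_def)
  qed
qed

lemma self_dual_generator_dvd:
  fixes g :: "'a::field poly"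
  assumes "c \<noteq> 0" "g * h = smult c M"
  shows "g dvd M"
  using dvd_triv_left[of g h] assms by (simp add: dvd_smult_iff)

text \<open>The factorisation forces \<open>g\<close> to divide the modulus, so
  \<open>code_of n\<close> is a bijection from these monic \<open>g\<close> onto the codes
  counted.\<close>

lemma NH_eq_card_generators:
  assumes hom: "field_hom (\<lambda>x::'a::{field,finite}. x ^ q)" and n: "n > 0"
  shows "NH TYPE('a) q n = card {g :: 'a poly. lead_coeff g = 1 \<and>
    (\<exists>c. c \<noteq> 0 \<and> g * conj_recip q g = smult c (monom 1 n + 1))}" (is "_ = card ?T")
proof -
  have T: "g dvd monom 1 n + 1" if "g \<in> ?T" for g
    using that self_dual_generator_dvd by blast
  have "bij_betw (code_of n) ?T
      {C :: 'a list set. linear_code n C \<and> negacyclic C \<and> herm_self_dual q n C}"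
  proof (rule bij_betwI')
    show "(code_of n f = code_of n g) = (f = g)" if "f \<in> ?T" "g \<in> ?T" for f g
      using code_of_inj[OF n T[OF that(1)] T[OF that(2)]] that by auto
    show "code_of n g \<in> {C. linear_code n C \<and> negacyclic C \<and> herm_self_dual q n C}"
      if "g \<in> ?T" for g
      using that linear_code_code_of negacyclic_code_of[OF n T[OF that]]
        herm_self_dual_code_of_iff[OF hom n T[OF that]] by auto
    show "\<exists>g\<in>?T. C = code_of n g"
      if C: "C \<in> {C. linear_code n C \<and> negacyclic C \<and> herm_self_dual q n C}" for C
    proof -
      obtain g where g: "lead_coeff g = 1" "g dvd monom 1 n + 1" "C = code_of n g"
        using negacyclic_code_generator[OF n] C by blast
      then show ?thesis
        using herm_self_dual_code_of_iff[OF hom n g(2)] C by auto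
    qed
  qed
  then show ?thesis
    unfolding NH_def by (simp add: bij_betw_same_card)
qed

section \<open>Roots of unity in the algebraic closure\<close>

lemma degree_monom_diff_const:
  fixes c :: "'a::field"
  shows "N > 0 \<Longrightarrow> degree (monom 1 N - [:c:]) = N"
  by (simp add: diff_conv_add_uminus degree_add_eq_left degree_monom_eq del: add_uminus_conv_diff)

text \<open>Roots are simple: the derivative \<open>N * x ^ (N - 1)\<close> can vanish only at 0,
  which is not a root since \<open>c \<noteq> 0\<close>.\<close>

lemma order_monom_diff_const:
  fixes c :: "'a::field"
  assumes "of_nat N \<noteq> (0 :: 'a)" "c \<noteq> 0"
  shows "order a (monom 1 N - [:c:]) = (if a ^ N = c then 1 else 0)"
proof -
  define f where "f = monom 1 N - [:c:]"
  have N: "N > 0"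
    using assms(1) by (cases N) auto
  have f: "f \<noteq> 0"
    using degree_monom_diff_const[OF N, of c] N by (auto simp: f_def)
  have root: "poly f a = 0 \<longleftrightarrow> a ^ N = c"
    by (simp add: f_def poly_monom)
  have "order a f \<le> 1" if a: "a ^ N = c"
  proof (rule ccontr)
    assume "\<not> order a f \<le> 1"
    then have "[:- a, 1:] ^ 2 dvd f"
      by (simp add: order_divides)
    then obtain u where "f = [:- a, 1:] ^ 2 * u"
      by (elim dvdE)
    then have u: "f = [:- a, 1:] * ([:- a, 1:] * u)"
      by (simp only: power2_eq_square mult.assoc)
    have "poly (pderiv f) a = 0"
      unfolding u pderiv_mult by simp
    moreover have "pderiv f = monom (of_nat N) (N - 1)"
      by (simp add: f_def pderiv_diff pderiv_monom)
    ultimately have "of_nat N * a ^ (N - 1) = 0"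
      by (simp add: poly_monom)
    then have "a = 0"
      using assms(1) by simp
    then show False
      using a N assms(2) by (simp add: power_0_left)
  qed
  moreover have "order a f = 0 \<longleftrightarrow> a ^ N \<noteq> c"
    using f by (simp add: order_eq_0_iff root)
  ultimately show ?thesis
    unfolding f_def[symmetric] by (cases "a ^ N = c") auto
qed

lemma finite_roots_of: "N > 0 \<Longrightarrow> finite {x :: 'a::field. x ^ N = c}"
  using poly_roots_finite[of "monom 1 N - [:c:]"] degree_monom_diff_const[of N c]
  by (cases "monom 1 N - [:c:] = 0") (auto simp: poly_monom)

text \<open>As all roots are simple, \<open>x ^ N - c\<close> divides the product of
  \<open>x - a\<close> over its distinct roots, which bounds \<open>N\<close> by their
  number.\<close>

lemma card_roots_of:
  fixes c :: "'a::alg_closed_field"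
  assumes "of_nat N \<noteq> (0 :: 'a)" "c \<noteq> 0"
  shows "card {x. x ^ N = c} = N"
proof -
  define f where "f = monom 1 N - [:c:]"
  define R where "R = {x. x ^ N = c}"
  have N: "N > 0"
    using assms(1) by (cases N) auto
  have deg: "degree f = N" and f: "f \<noteq> 0"
    using degree_monom_diff_const[OF N, of c] N by (auto simp: f_def)
  have fin: "finite R"
    unfolding R_def by (rule finite_roots_of[OF N])
  have prod: "(\<Prod>a\<in>R. [:- a, 1:] ^ 1) \<noteq> 0"
    using fin by simp
  have "order x f \<le> order x (\<Prod>a\<in>R. [:- a, 1:] ^ 1)" for x
    unfolding f_def order_monom_diff_const[OF assms] order_prod_linear_factors[OF fin]
    by (simp add: R_def)
  then have "f dvd (\<Prod>a\<in>R. [:- a, 1:] ^ 1)"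
    using f prod by (rule alg_closed_dvdI[rotated 2])
  then have "degree f \<le> degree (\<Prod>a\<in>R. [:- a, 1:] ^ 1)"
    using prod by (rule dvd_imp_degree_le)
  also have "\<dots> = card R"
    by (subst degree_prod_sum_eq) auto
  finally have "N \<le> card R"
    by (simp add: deg)
  moreover have "R = {x. poly f x = 0}"
    by (auto simp: R_def f_def poly_monom)
  then have "card R \<le> N"
    using card_poly_roots_bound[OF f] deg by simp
  ultimately show ?thesis
    by (simp add: R_def)
qed

section \<open>Elements of given multiplicative order\<close>

text \<open>The order is encoded by its divisibility property; \<open>d = 0\<close> stands for an
  element with no positive power equal to 1.\<close>

definition has_mult_order :: "'a::field \<Rightarrow> nat \<Rightarrow> bool" where
  "has_mult_order x d \<longleftrightarrow> (\<forall>k. x ^ k = 1 \<longleftrightarrow> d dvd k)"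

lemma has_mult_order_unique: "has_mult_order x d \<Longrightarrow> has_mult_order x e \<Longrightarrow> d = e"
  unfolding has_mult_order_def by (metis dvd_antisym dvd_refl)

lemma has_mult_order_exists:
  fixes x :: "'a::field"
  assumes "x ^ N = 1" "N > 0"
  obtains d where "has_mult_order x d" "d dvd N"
proof -
  define d where "d = (LEAST k. k > 0 \<and> x ^ k = 1)"
  have d: "d > 0" "x ^ d = 1"
    using LeastI[of "\<lambda>k. k > 0 \<and> x ^ k = 1" N] assms by (auto simp: d_def)
  have "x ^ k = 1 \<longleftrightarrow> d dvd k" for k
  proof
    assume "x ^ k = 1"
    moreover have "x ^ k = x ^ (k mod d) * (x ^ d) ^ (k div d)"
      by (simp flip: power_mult power_add)
    ultimately have "x ^ (k mod d) = 1"
      using d(2) by simp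
    moreover have "k mod d < d"
      using d(1) by simp
    ultimately have "\<not> k mod d > 0"
      using not_less_Least[of "k mod d" "\<lambda>k. k > 0 \<and> x ^ k = 1"] by (auto simp: d_def)
    then show "d dvd k"
      by (simp add: dvd_eq_mod_eq_0)
  next
    assume "d dvd k"
    then show "x ^ k = 1"
      using d(2) by (auto simp: power_mult)
  qed
  then have "has_mult_order x d" "d dvd N"
    using assms(1) by (simp_all add: has_mult_order_def)
  then show thesis
    by (rule that)
qed

lemma has_mult_order_power: "has_mult_order x d \<Longrightarrow> x ^ k = 1 \<longleftrightarrow> d dvd k"
  by (simp add: has_mult_order_def)

lemma finite_has_mult_order:
  assumes "d > 0"
  shows "finite {x :: 'a::field. has_mult_order x d}"
proof (rule finite_subset[OF _ finite_roots_of[OF assms, of 1]])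
  show "{x :: 'a. has_mult_order x d} \<subseteq> {x. x ^ d = 1}"
    by (simp add: has_mult_order_power Collect_mono)
qed

text \<open>Sorting the \<open>d\<close> roots of \<open>x ^ d = 1\<close> by order gives the same
  divisor sum as the identity for \<open>totient\<close>; strong induction removes the proper
  divisors.\<close>

lemma card_has_mult_order:
  assumes "of_nat d \<noteq> (0 :: 'a::alg_closed_field)"
  shows "card {x :: 'a. has_mult_order x d} = totient d"
  using assms
proof (induction d rule: less_induct)
  case (less d)
  let ?A = "\<lambda>e. {x :: 'a. has_mult_order x e}"
  let ?D = "{e. e dvd d}"
  have d: "d > 0"
    using less.prems by (cases d) auto
  have D: "finite ?D" "d \<in> ?D"
    using d by auto
  have pos: "e > 0" if "e dvd d" for e
    using that d by (rule dvd_pos_nat[rotated])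
  have "{x :: 'a. x ^ d = 1} = (\<Union>e\<in>?D. ?A e)"
  proof
    show "{x :: 'a. x ^ d = 1} \<subseteq> (\<Union>e\<in>?D. ?A e)"
      using has_mult_order_exists[OF _ d] by blast
  qed (auto simp: has_mult_order_power)
  then have "d = card (\<Union>e\<in>?D. ?A e)"
    using card_roots_of[OF less.prems, of 1] by simp
  also have "\<dots> = (\<Sum>e\<in>?D. card (?A e))"
    using D(1) by (intro card_UN_disjoint) (auto intro!: finite_has_mult_order pos dest: has_mult_order_unique)
  also have "\<dots> = card (?A d) + (\<Sum>e\<in>?D - {d}. card (?A e))"
    using D by (rule sum.remove)
  also have "(\<Sum>e\<in>?D - {d}. card (?A e)) = (\<Sum>e\<in>?D - {d}. totient e)"
  proof (intro sum.cong refl less.IH)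
    fix e assume e: "e \<in> ?D - {d}"
    then show "e < d"
      using dvd_imp_le[of e d] d by auto
    show "of_nat e \<noteq> (0 :: 'a)"
      using e less.prems by auto
  qed
  finally have "d = card (?A d) + (\<Sum>e\<in>?D - {d}. totient e)" .
  moreover have "d = totient d + (\<Sum>e\<in>?D - {d}. totient e)"
    using totient_divisor_sum[of d] sum.remove[OF D, of totient] by simp
  ultimately show ?case
    by simp
qed

section \<open>Root multiplicities of the modulus\<close>

lemma order_power:
  fixes f :: "'a::field poly"
  assumes "f \<noteq> 0"
  shows "order a (f ^ k) = k * order a f"
  using assms by (induction k) (simp_all add: order_mult)

text \<open>In characteristic \<open>p\<close> the modulus is a \<open>p ^ r\<close>-th power of
  \<open>x ^ m + 1\<close>, which has only simple roots.\<close>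

lemma order_negacyclic_modulus:
  fixes a :: "'a::field"
  assumes "prime CHAR('a)" "of_nat m \<noteq> (0 :: 'a)"
  shows "order a (monom 1 (m * CHAR('a) ^ r) + 1) = (if a ^ m = - 1 then CHAR('a) ^ r else 0)"
proof -
  define f :: "'a poly" where "f = monom 1 m - [:- 1:]"
  have m: "m > 0"
    using assms(2) by (cases m) auto
  have f: "f \<noteq> 0"
    using degree_monom_diff_const[OF m, of "-1 :: 'a"] m by (auto simp: f_def)
  have f_eq: "f = monom 1 m + 1"
    by (simp add: f_def one_pCons)
  have "f ^ (CHAR('a) ^ r) = monom 1 m ^ (CHAR('a) ^ r) + 1 ^ (CHAR('a) ^ r)"
    unfolding f_eq by (rule freshmans_dream'[of _ r]) (use assms(1) in simp_all)
  then have "monom 1 (m * CHAR('a) ^ r) + 1 = f ^ (CHAR('a) ^ r)"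
    by (simp add: monom_power)
  then show ?thesis
    using order_power[OF f, of a] order_monom_diff_const[OF assms(2), of "- 1" a]
    by (simp add: f_def)
qed

section \<open>Frobenius maps and the base field inside its closure\<close>

lemma field_hom_frobenius:
  assumes "prime CHAR('a::field)"
  shows "field_hom (\<lambda>x::'a. x ^ (CHAR('a) ^ k))"
  by standard (use freshmans_dream'[OF assms refl] in \<open>auto simp: power_mult_distrib\<close>)

lemma to_ac_hom: "field_hom (to_ac :: 'a::field \<Rightarrow> _)"
  by standard simp_all

text \<open>Every element of the finite field is a root of \<open>x ^ Q - x\<close>, and this
  polynomial has no room for further roots. The lemma is the criterion for descending coefficients
  to the base field.\<close>

lemma range_to_ac_eq:
  "range (to_ac :: 'a::{field,finite} \<Rightarrow> _) = {x. x ^ card (UNIV :: 'a set) = x}"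
proof (rule card_subset_eq)
  let ?Q = "card (UNIV :: 'a set)"
  have "card {0, 1 :: 'a} \<le> ?Q"
    by (rule card_mono) auto
  then have Q: "?Q > 1"
    by simp
  define f :: "'a alg_closure poly" where "f = monom 1 ?Q - [:0, 1:]"
  have deg: "degree f = ?Q"
    unfolding f_def diff_conv_add_uminus using Q
    by (subst degree_add_eq_left) (simp_all add: degree_monom_eq)
  then have f: "f \<noteq> 0"
    using Q by auto
  have roots: "{x. x ^ ?Q = x} = {x. poly f x = 0}"
    by (auto simp: f_def poly_monom)
  show fin: "finite {x :: 'a alg_closure. x ^ ?Q = x}"
    unfolding roots by (rule poly_roots_finite[OF f])
  have "x ^ ?Q = x" for x :: 'a
  proof (cases "x = 0")
    case False
    \<comment> \<open>Multiplication by \<open>x\<close> permutes the nonzero elements; comparing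
      the two products yields \<open>x ^ (Q - 1) = 1\<close>.\<close>
    have "(\<Prod>y\<in>UNIV - {0}. x * y) = (\<Prod>y\<in>UNIV - {0}. y)"
      by (rule prod.reindex_bij_witness[of _ "\<lambda>y. y / x" "\<lambda>y. x * y"]) (use False in auto)
    then have "x ^ card (UNIV - {0 :: 'a}) = 1"
      by (simp add: prod.distrib)
    then have "x ^ (?Q - 1) = 1"
      by (simp add: card_Diff_subset)
    then have "x * x ^ (?Q - 1) = x"
      by simp
    then show ?thesis
      using Q by (simp flip: power_Suc)
  qed (use Q in simp)
  then have "to_ac x ^ ?Q = to_ac x" for x :: 'a
    by (simp flip: to_ac_power)
  then show sub: "range (to_ac :: 'a \<Rightarrow> _) \<subseteq> {x. x ^ ?Q = x}"
    by auto
  have card: "card (range (to_ac :: 'a \<Rightarrow> _)) = ?Q"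
    by (rule card_image[OF inj_to_ac])
  moreover have "card {x :: 'a alg_closure. x ^ ?Q = x} \<le> ?Q"
    unfolding roots using card_poly_roots_bound[OF f] deg by simp
  moreover have "card (range (to_ac :: 'a \<Rightarrow> _)) \<le> card {x :: 'a alg_closure. x ^ ?Q = x}"
    by (rule card_mono[OF fin sub])
  ultimately show "card (range (to_ac :: 'a \<Rightarrow> _)) = card {x :: 'a alg_closure. x ^ ?Q = x}"
    by linarith
qed

section \<open>Generators and root multiplicities\<close>

text \<open>Conjugation moves a root \<open>b\<close> to \<open>b ^ q\<close> and reflection then
  inverts it, both keeping multiplicities.\<close>

lemma order_to_ac_conj_recip:
  fixes g :: "'a::field poly"
  assumes F: "field_hom (\<lambda>x::'a. x ^ q)" and K: "field_hom (\<lambda>x::'a alg_closure. x ^ q)"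
    and "g \<noteq> 0" "b \<noteq> 0"
  shows "order (inverse b ^ q) (map_poly to_ac (conj_recip q g)) = order b (map_poly to_ac g)"
proof -
  interpret F: field_hom "\<lambda>x::'a. x ^ q"
    by (rule F)
  interpret K: field_hom "\<lambda>x::'a alg_closure. x ^ q"
    by (rule K)
  interpret A: field_hom "to_ac :: 'a \<Rightarrow> _"
    by (rule to_ac_hom)
  let ?G = "map_poly to_ac g"
  have G: "?G \<noteq> 0"
    using assms(3) by (simp add: A.map_poly_hom_eq_0_iff)
  have "map_poly to_ac (map_poly (\<lambda>x. x ^ q) g) = map_poly (\<lambda>x. x ^ q) ?G"
    by (rule poly_eqI) (simp add: A.coeff_hom F.coeff_hom K.coeff_hom)
  then have "map_poly to_ac (conj_recip q g) = reflect_poly (map_poly (\<lambda>x. x ^ q) ?G)"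
    by (simp add: conj_recip_def A.map_poly_reflect)
  then have "order (inverse b ^ q) (map_poly to_ac (conj_recip q g)) =
      order (inverse (b ^ q)) (reflect_poly (map_poly (\<lambda>x. x ^ q) ?G))"
    by (simp add: power_inverse)
  also have "\<dots> = order (b ^ q) (map_poly (\<lambda>x. x ^ q) ?G)"
    using G assms(4) by (intro order_reflect_poly) (simp_all add: K.map_poly_hom_eq_0_iff)
  also have "\<dots> = order b ?G"
    using G by (rule K.order_map_poly)
  finally show ?thesis .
qed

text \<open>The bijection records multiplicities on \<open>S\<close>. It is injective because these
  determine a monic polynomial, and surjective because a product of linear factors with admissible
  exponents descends to the base field.\<close>

lemma card_generators_eq_card_exponents:
  fixes n m q P :: nat
  defines "S \<equiv> {a :: 'a::{field,finite} alg_closure. a ^ m = - 1}"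
  assumes F: "field_hom (\<lambda>x::'a. x ^ q)" and K: "field_hom (\<lambda>x::'a alg_closure. x ^ q)"
    and Q: "card (UNIV :: 'a set) = q ^ 2" and q: "odd q" and m: "m > 0" and n: "n > 0"
    and M: "\<And>a :: 'a alg_closure. order a (monom 1 n + 1) = (if a \<in> S then P else 0)"
  shows "card {g :: 'a poly. lead_coeff g = 1 \<and>
      (\<exists>c. c \<noteq> 0 \<and> g * conj_recip q g = smult c (monom 1 n + 1))} =
    card {e \<in> S \<rightarrow>\<^sub>E UNIV. \<forall>b\<in>S. e b + e (inverse b ^ q) = P}" (is "card ?T = card ?E")
proof -
  interpret F: field_hom "\<lambda>x::'a. x ^ q"
    by (rule F)
  interpret K: field_hom "\<lambda>x::'a alg_closure. x ^ q"
    by (rule K)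
  interpret A: field_hom "to_ac :: 'a \<Rightarrow> _"
    by (rule to_ac_hom)
  define \<sigma> :: "'a alg_closure \<Rightarrow> 'a alg_closure" where "\<sigma> b = inverse b ^ q" for b
  define M1 :: "'a poly" where "M1 = monom 1 n + 1"
  define M2 :: "'a alg_closure poly" where "M2 = monom 1 n + 1"
  have M12: "map_poly to_ac M1 = M2"
    by (simp add: M1_def M2_def A.map_poly_add map_poly_monom)
  have M2_nz: "M2 \<noteq> 0" "lead_coeff M2 = 1"
    using n lead_coeff_negacyclic_modulus[OF n, where ?'a = "'a alg_closure"] by (simp_all add: M2_def)
  have finS: "finite S"
    unfolding S_def by (rule finite_roots_of[OF m])
  have S0: "b \<noteq> 0" if "b \<in> S" for b
    using that m by (auto simp: S_def power_0_left)
  have \<sigma>_S: "\<sigma> b \<in> S" if "b \<in> S" for b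
  proof -
    have "(inverse b ^ q) ^ m = inverse (b ^ m) ^ q"
      by (simp add: power_inverse mult.commute flip: power_mult)
    then show ?thesis
      using that q by (simp add: S_def \<sigma>_def)
  qed
  have \<sigma>_inj: "inj_on \<sigma> S"
    by (rule inj_onI) (simp add: \<sigma>_def K.hom_eq_iff)
  have \<sigma>_bij: "bij_betw \<sigma> S S"
    using endo_inj_surj[OF finS _ \<sigma>_inj] \<sigma>_S \<sigma>_inj by (auto simp: bij_betw_def)
  have \<sigma>\<sigma>: "\<sigma> (\<sigma> b) = b ^ q\<^sup>2" for b
    by (simp add: \<sigma>_def power_inverse power2_eq_square flip: power_mult)
  have conj: "order (\<sigma> b) (map_poly to_ac (conj_recip q g)) = order b (map_poly to_ac g)"
    if "g \<noteq> 0" "b \<noteq> 0" for b and g :: "'a poly"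
    unfolding \<sigma>_def by (rule order_to_ac_conj_recip[OF F K that])
  define ev where "ev g = restrict (\<lambda>b. order b (map_poly to_ac g)) S" for g :: "'a poly"
  have T_order: "order b (map_poly to_ac g) + order b (map_poly to_ac (conj_recip q g)) =
      (if b \<in> S then P else 0)" if "g \<in> ?T" for b g
  proof -
    from that obtain c where c: "c \<noteq> 0" "g * conj_recip q g = smult c M1"
      by (auto simp: M1_def)
    then have eq: "map_poly to_ac g * map_poly to_ac (conj_recip q g) = smult (to_ac c) M2"
      by (simp add: map_poly_smult M12 flip: A.map_poly_mult)
    then have "map_poly to_ac g * map_poly to_ac (conj_recip q g) \<noteq> 0"
      using M2_nz c(1) by simp
    then have "order b (map_poly to_ac g) + order b (map_poly to_ac (conj_recip q g)) =
        order b (smult (to_ac c) M2)"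
      unfolding eq[symmetric] by (rule order_mult[symmetric])
    also have "\<dots> = order b M2"
      using c(1) by (simp add: order_smult)
    finally show ?thesis
      using M by (simp add: M2_def)
  qed
  have "bij_betw ev ?T ?E"
  proof (rule bij_betwI')
    fix f g assume fg: "f \<in> ?T" "g \<in> ?T"
    have nz: "f \<noteq> 0" "g \<noteq> 0"
      using fg by auto
    show "(ev f = ev g) = (f = g)"
    proof
      assume eq: "ev f = ev g"
      have "order b (map_poly to_ac f) = order b (map_poly to_ac g)" for b
      proof (cases "b \<in> S")
        case True
        then show ?thesis
          using fun_cong[OF eq, of b] by (simp add: ev_def)
      next
        case False
        then show ?thesis
          using T_order[OF fg(1), of b] T_order[OF fg(2), of b] by simp
      qed
      then have "smult (lead_coeff (map_poly to_ac g)) (map_poly to_ac f) =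
          smult (lead_coeff (map_poly to_ac f)) (map_poly to_ac g)"
        using nz by (intro alg_closed_eqI) (simp_all add: A.map_poly_hom_eq_0_iff)
      then have "map_poly to_ac f = map_poly to_ac g"
        using fg by (simp add: A.degree_hom A.coeff_hom)
      then show "f = g"
        by (simp add: A.map_poly_hom_eq_iff)
    qed simp
  next
    fix g assume g: "g \<in> ?T"
    then have "g \<noteq> 0"
      by auto
    \<comment> \<open>\<open>T_order\<close> is used at \<open>\<sigma> b\<close>, where the
      conjugate reciprocal has the multiplicity that \<open>g\<close> has at
      \<open>b\<close>.\<close>
    then have "order b (map_poly to_ac g) + order (\<sigma> b) (map_poly to_ac g) = P" if "b \<in> S" for b
      using T_order[OF g, of "\<sigma> b"] \<sigma>_S[OF that] conj[OF _ S0[OF that], of g] by simp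
    then show "ev g \<in> ?E"
      using \<sigma>_S by (auto simp: ev_def \<sigma>_def)
  next
    fix e assume e: "e \<in> ?E"
    then have e_sum: "e b + e (\<sigma> b) = P" if "b \<in> S" for b
      using that by (simp add: \<sigma>_def)
    define G where "G = (\<Prod>a\<in>S. [:- a, 1:] ^ e a)"
    have lcG: "lead_coeff G = 1"
      by (simp add: G_def lead_coeff_prod lead_coeff_power)
    have orderG: "order b G = (if b \<in> S then e b else 0)" for b
      unfolding G_def by (rule order_prod_linear_factors[OF finS])
    \<comment> \<open>The Frobenius map of the base field, which has \<open>q ^ 2\<close> elements;
      it equals \<open>\<sigma>\<close> applied twice.\<close>
    define \<phi> :: "'a alg_closure \<Rightarrow> 'a alg_closure" where "\<phi> x = x ^ q\<^sup>2" for x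
    interpret \<phi>: field_hom \<phi>
      by standard (simp_all add: \<phi>_def power2_eq_square power_mult K.hom_add K.hom_mult)
    have \<phi>_bij: "bij_betw \<phi> S S"
      using bij_betw_trans[OF \<sigma>_bij \<sigma>_bij] by (simp add: comp_def \<sigma>\<sigma> \<phi>_def[abs_def])
    \<comment> \<open>Both values equal \<open>P - e (\<sigma> b)\<close>.\<close>
    have e_\<phi>: "e (\<phi> b) = e b" if "b \<in> S" for b
      using e_sum[OF that] e_sum[OF \<sigma>_S[OF that]] by (simp add: \<phi>_def \<sigma>\<sigma>)
    \<comment> \<open>Applying \<open>\<phi>\<close> to the coefficients only permutes the linear
      factors, so each coefficient is fixed and comes from the base field.\<close>
    have "map_poly \<phi> G = (\<Prod>a\<in>S. [:- \<phi> a, 1:] ^ e (\<phi> a))"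
      unfolding G_def \<phi>.map_poly_prod
      by (intro prod.cong) (simp_all add: \<phi>.map_poly_power \<phi>.map_poly_linear \<phi>.hom_uminus \<phi>.hom_one e_\<phi>)
    also have "\<dots> = G"
      unfolding G_def by (rule prod.reindex_bij_betw[OF \<phi>_bij])
    finally have "\<phi> (coeff G i) = coeff G i" for i
      by (metis \<phi>.coeff_hom)
    then have "coeff G i \<in> range to_ac" for i
      by (simp add: range_to_ac_eq Q \<phi>_def)
    then have coeffG: "to_ac (of_ac (coeff G i)) = coeff G i" for i
      by (rule to_ac_of_ac)
    define g where "g = map_poly of_ac G"
    have gG: "map_poly to_ac g = G"
      by (rule poly_eqI) (simp add: A.coeff_hom g_def coeff_map_poly coeffG)
    have "degree g = degree G"
      using A.degree_hom[of g] by (simp add: gG)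
    then have "to_ac (lead_coeff g) = 1"
      using lcG by (simp add: gG flip: A.coeff_hom)
    then have lcg: "lead_coeff g = 1"
      by simp
    then have g_nz: "g \<noteq> 0" "conj_recip q g \<noteq> 0"
      by (auto simp: conj_recip_def F.map_poly_hom_eq_0_iff)
    let ?H = "map_poly to_ac (g * conj_recip q g)"
    have H_nz: "?H \<noteq> 0"
      using g_nz by (simp add: A.map_poly_hom_eq_0_iff)
    have "order b ?H = order b M2" for b
    proof -
      have split: "order b ?H = order b G + order b (map_poly to_ac (conj_recip q g))"
        using H_nz unfolding A.map_poly_mult gG by (rule order_mult)
      show ?thesis
      proof (cases "b = 0")
        case True
        \<comment> \<open>The constant coefficient is the conjugated leading coefficient of
          \<open>g\<close>, namely 1. The point 0 is treated apart because \<open>conj\<close> needs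
          a nonzero argument.\<close>
        have "poly (conj_recip q g) 0 \<noteq> 0"
          using lcg F.hom_one by (simp add: conj_recip_def F.degree_hom F.coeff_hom)
        then have "poly (map_poly to_ac (conj_recip q g)) (to_ac 0) \<noteq> 0"
          unfolding A.poly_map_poly_hom A.hom_eq_0_iff .
        then have "order b (map_poly to_ac (conj_recip q g)) = 0"
          using True by (intro order_0I) simp
        then show ?thesis
          using split orderG[of b] M[of b] S0[of b] True by (auto simp: M2_def)
      next
        case False
        \<comment> \<open>The closure contains \<open>q\<close>-th roots, so every nonzero
          \<open>b\<close> is some \<open>\<sigma> b1\<close>, and the multiplicity of the conjugate
          reciprocal at \<open>b\<close> is that of \<open>G\<close> at \<open>b1\<close>.\<close>
        obtain b1 where b1: "b1 ^ q = inverse b"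
          using nth_root_exists[of q "inverse b"] q by (auto simp: odd_pos)
        then have b1_nz: "b1 \<noteq> 0"
          using False odd_pos[OF q] by (auto simp: power_0_left)
        have b: "b = \<sigma> b1"
          using b1 by (simp add: \<sigma>_def power_inverse)
        have H: "order b ?H = order (\<sigma> b1) G + order b1 G"
          using split conj[OF g_nz(1) b1_nz] by (simp add: b gG)
        show ?thesis
        proof (cases "b1 \<in> S")
          case True
          then show ?thesis
            using H e_sum[OF True] \<sigma>_S[OF True] M[of b] by (simp add: b orderG M2_def)
        next
          case False
          have "b \<notin> S"
          proof
            assume "b \<in> S"
            then have "\<sigma> b1 \<in> \<sigma> ` S"
              using \<sigma>_bij b by (simp add: bij_betw_def)
            then obtain b2 where "b2 \<in> S" "\<sigma> b2 = \<sigma> b1"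
              by auto
            then show False
              using False by (simp add: \<sigma>_def K.hom_eq_iff)
          qed
          then show ?thesis
            using H False M[of b] by (simp add: b orderG M2_def)
        qed
      qed
    qed
    then have "smult (lead_coeff M2) ?H = smult (lead_coeff ?H) M2"
      using H_nz M2_nz(1) by (intro alg_closed_eqI)
    then have "?H = map_poly to_ac (smult (lead_coeff (g * conj_recip q g)) M1)"
      using M2_nz(2) by (simp add: map_poly_smult M12 A.degree_hom A.coeff_hom)
    then have "g * conj_recip q g = smult (lead_coeff (g * conj_recip q g)) M1"
      unfolding A.map_poly_hom_eq_iff .
    moreover have "lead_coeff (g * conj_recip q g) \<noteq> 0"
      using g_nz by simp
    ultimately have "g \<in> ?T"
      using lcg unfolding M1_def by blast
    moreover have "ev g = e"
    proof
      fix b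
      show "ev g b = e b"
        using e by (cases "b \<in> S") (auto simp: ev_def gG orderG PiE_def extensional_def)
    qed
    ultimately show "\<exists>g\<in>?T. e = ev g"
      by blast
  qed
  then show ?thesis
    by (rule bij_betw_same_card)
qed

section \<open>Functions alternating along a permutation\<close>

text \<open>Along an orbit the values alternate between \<open>v\<close> and \<open>P - v\<close>,
  which closes up because the length \<open>t x\<close> is even; so each orbit has
  \<open>P + 1\<close> choices. The number \<open>k\<close> of orbits is given as a sum of
  reciprocal lengths, ready to be sorted by the order of the roots.\<close>

lemma card_alternating_functions:
  fixes \<sigma> :: "'a \<Rightarrow> 'a" and t :: "'a \<Rightarrow> nat"
  assumes fin: "finite S" and \<sigma>_S: "\<And>x. x \<in> S \<Longrightarrow> \<sigma> x \<in> S"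
    and period: "\<And>x j. x \<in> S \<Longrightarrow> (\<sigma> ^^ j) x = x \<longleftrightarrow> t x dvd j"
    and t_pos: "\<And>x. x \<in> S \<Longrightarrow> t x > 0" and t_even: "\<And>x. x \<in> S \<Longrightarrow> even (t x)"
  obtains k where "card {e \<in> S \<rightarrow>\<^sub>E UNIV. \<forall>x\<in>S. e x + e (\<sigma> x) = (P::nat)} = (P + 1) ^ k"
    and "real k = (\<Sum>x\<in>S. 1 / real (t x))"
proof -
  define R where "R = {(x, y). x \<in> S \<and> (\<exists>j. y = (\<sigma> ^^ j) x)}"
  have pow_S: "(\<sigma> ^^ j) x \<in> S" if "x \<in> S" for x j
    using that \<sigma>_S by (induction j) auto
  \<comment> \<open>Instead of inverting \<open>\<sigma>\<close>, one moves forward to the next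
    convenient multiple of the period.\<close>
  have return: "(\<sigma> ^^ (t x * j - j)) ((\<sigma> ^^ j) x) = x" if "x \<in> S" for x j
  proof -
    have "j \<le> t x * j"
      using t_pos[OF that] by simp
    then have "(\<sigma> ^^ (t x * j - j)) ((\<sigma> ^^ j) x) = (\<sigma> ^^ (t x * j)) x"
      by (simp flip: funpow_add comp_apply[of "\<sigma> ^^ (t x * j - j)"])
    also have "\<dots> = x"
      using period[OF that] by simp
    finally show ?thesis .
  qed
  have eq_iff: "t x dvd (t x * i - i) + j" if "x \<in> S" "(\<sigma> ^^ i) x = (\<sigma> ^^ j) x" for x i j
  proof -
    have "(\<sigma> ^^ ((t x * i - i) + j)) x = (\<sigma> ^^ (t x * i - i)) ((\<sigma> ^^ i) x)"
      using that(2) by (simp add: funpow_add)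
    then show ?thesis
      using return[OF that(1)] period[OF that(1)] by simp
  qed
  \<comment> \<open>As the period is even, the parity of the number of steps between two points of
    an orbit is well defined.\<close>
  have parity: "even i \<longleftrightarrow> even j" if "x \<in> S" "(\<sigma> ^^ i) x = (\<sigma> ^^ j) x" for x i j
  proof -
    have "even ((t x * i - i) + j)"
      using eq_iff[OF that] t_even[OF that(1)] by (rule dvd_trans[rotated])
    moreover have "i \<le> t x * i" "even (t x * i)"
      using t_pos[OF that(1)] t_even[OF that(1)] by simp_all
    ultimately show ?thesis
      by simp
  qed
  have equiv: "equiv S R"
  proof (rule equivI)
    show "R \<subseteq> S \<times> S"
      using pow_S by (auto simp: R_def)
    show "refl_on S R"
      by (rule refl_onI) (auto simp: R_def intro: exI[of _ 0])
    show "sym R"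
    proof (rule symI)
      fix x y assume "(x, y) \<in> R"
      then obtain j where j: "x \<in> S" "y = (\<sigma> ^^ j) x"
        by (auto simp: R_def)
      then show "(y, x) \<in> R"
        using pow_S return[OF j(1), of j] by (auto simp: R_def intro: exI[of _ "t x * j - j"])
    qed
    show "trans R"
    proof (rule transI)
      fix x y z assume "(x, y) \<in> R" "(y, z) \<in> R"
      then obtain i j where "x \<in> S" "y = (\<sigma> ^^ i) x" "z = (\<sigma> ^^ j) y"
        by (auto simp: R_def)
      then show "(x, z) \<in> R"
        by (auto simp: R_def funpow_add intro: exI[of _ "j + i"])
    qed
  qed
  have card_class: "card (R `` {x}) = t x" if x: "x \<in> S" for x
  proof -
    have "R `` {x} = (\<lambda>j. (\<sigma> ^^ j) x) ` {..<t x}"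
    proof
      show "R `` {x} \<subseteq> (\<lambda>j. (\<sigma> ^^ j) x) ` {..<t x}"
      proof
        fix y assume "y \<in> R `` {x}"
        then obtain j where j: "y = (\<sigma> ^^ j) x"
          by (auto simp: R_def)
        have "(\<sigma> ^^ j) x = (\<sigma> ^^ (j mod t x)) ((\<sigma> ^^ (t x * (j div t x))) x)"
          by (simp flip: funpow_add comp_apply[of "\<sigma> ^^ (j mod t x)"])
        also have "(\<sigma> ^^ (t x * (j div t x))) x = x"
          using period[OF x] by simp
        finally show "y \<in> (\<lambda>j. (\<sigma> ^^ j) x) ` {..<t x}"
          using j t_pos[OF x] by auto
      qed
    qed (use x in \<open>auto simp: R_def\<close>)
    moreover have "inj_on (\<lambda>j. (\<sigma> ^^ j) x) {..<t x}"
    proof (rule inj_onI)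
      have le: "i \<le> j" if "j < t x" "i < t x" "(\<sigma> ^^ i) x = (\<sigma> ^^ j) x" for i j
      proof (rule ccontr)
        assume "\<not> i \<le> j"
        then have ij: "i - j > 0" "i - j < t x"
          using that by auto
        have "(t x * i - i) + i = t x * i"
          using t_pos[OF x] by simp
        then have "t x dvd (t x * i - i) + i"
          by (simp only: dvd_triv_left)
        then have "t x dvd ((t x * i - i) + i) - ((t x * i - i) + j)"
          using eq_iff[OF x that(3)] by (rule dvd_diff_nat)
        then have "t x dvd i - j"
          by (simp only: add_diff_cancel_left)
        then show False
          using ij dvd_imp_le by fastforce
      qed
      fix i j assume "i \<in> {..<t x}" "j \<in> {..<t x}" "(\<sigma> ^^ i) x = (\<sigma> ^^ j) x"
      then show "i = j"
        using le[of j i] le[of i j] by simp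
    qed
    ultimately show ?thesis
      by (simp add: card_image)
  qed
  define k where "k = card (S // R)"
  have finQ: "finite (S // R)"
    using fin by (rule finite_quotient[OF _ equiv_type[OF equiv]])
  \<comment> \<open>Each element of an orbit \<open>c\<close> has weight \<open>1 / card c\<close>,
    so every orbit contributes 1.\<close>
  have "(\<Sum>x\<in>S. 1 / real (t x)) = (\<Sum>c\<in>S // R. \<Sum>x | x \<in> S \<and> R `` {x} = c. 1 / real (t x))"
    by (rule sum.group[symmetric, OF fin finQ]) (auto simp: quotientI)
  also have "\<dots> = (\<Sum>c\<in>S // R. 1)"
  proof (rule sum.cong[OF refl])
    fix c assume c: "c \<in> S // R"
    then obtain z where z: "z \<in> S" "c = R `` {z}"
      by (auto elim: quotientE)
    have cls: "{x. x \<in> S \<and> R `` {x} = c} = c"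
      using equiv_class_eq_iff[OF equiv] z by auto
    have "t x = card c" if "x \<in> c" for x
    proof -
      have "x \<in> {x. x \<in> S \<and> R `` {x} = c}"
        using that unfolding cls .
      then show ?thesis
        using card_class[of x] by auto
    qed
    then have "(\<Sum>x\<in>c. 1 / real (t x)) = (\<Sum>x\<in>c. 1 / real (card c))"
      by (intro sum.cong) auto
    also have "\<dots> = 1"
      using card_class[OF z(1)] t_pos[OF z(1)] z by simp
    finally show "(\<Sum>x | x \<in> S \<and> R `` {x} = c. 1 / real (t x)) = 1"
      unfolding cls .
  qed
  finally have k_sum: "real k = (\<Sum>x\<in>S. 1 / real (t x))"
    by (simp add: k_def)
  define rep where "rep c = (SOME x. x \<in> c)" for c :: "'a set"
  have rep_in: "rep c \<in> c" if "c \<in> S // R" for c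
  proof -
    from that obtain z where "z \<in> S" "c = R `` {z}"
      by (auto elim: quotientE)
    then have "z \<in> c"
      using equiv_class_self[OF equiv] by simp
    then show ?thesis
      unfolding rep_def by (rule someI)
  qed
  have rep_S: "rep c \<in> S" and rep_class: "R `` {rep c} = c" if "c \<in> S // R" for c
  proof -
    from that obtain z where z: "z \<in> S" "c = R `` {z}"
      by (auto elim: quotientE)
    then have zR: "(z, rep c) \<in> R"
      using rep_in[OF that] by auto
    then show "rep c \<in> S"
      using equiv_type[OF equiv] by (auto simp: refl_on_def)
    show "R `` {rep c} = c"
      using equiv_class_eq[OF equiv zR] z(2) by simp
  qed
  have reach: "\<exists>j. x = (\<sigma> ^^ j) (rep (R `` {x}))" if "x \<in> S" for x
  proof -
    have c: "R `` {x} \<in> S // R"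
      using that by (rule quotientI)
    then have "x \<in> R `` {rep (R `` {x})}"
      using rep_class[OF c] equiv_class_self[OF equiv that] by simp
    then show ?thesis
      by (auto simp: R_def)
  qed
  \<comment> \<open>Some number of steps from the representative; only its parity will
    matter.\<close>
  define dist where "dist x = (SOME j. x = (\<sigma> ^^ j) (rep (R `` {x})))" for x
  have dist: "x = (\<sigma> ^^ dist x) (rep (R `` {x}))" if "x \<in> S" for x
    unfolding dist_def by (rule someI_ex[OF reach[OF that]])
  have class_\<sigma>: "R `` {\<sigma> x} = R `` {x}" if "x \<in> S" for x
  proof -
    have "(x, \<sigma> x) \<in> R"
      using that by (auto simp: R_def intro: exI[of _ 1])
    then show ?thesis
      using equiv_class_eq[OF equiv] by blast
  qed
  have dist_\<sigma>: "even (dist (\<sigma> x)) \<longleftrightarrow> odd (dist x)" if "x \<in> S" for x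
  proof -
    have rS: "rep (R `` {x}) \<in> S"
      using rep_S quotientI[OF that] by blast
    have "(\<sigma> ^^ dist (\<sigma> x)) (rep (R `` {x})) = \<sigma> x"
      using dist[OF \<sigma>_S[OF that]] class_\<sigma>[OF that] by simp
    also have "\<dots> = (\<sigma> ^^ Suc (dist x)) (rep (R `` {x}))"
      using dist[OF that] by simp
    finally show ?thesis
      using parity[OF rS, of "dist (\<sigma> x)" "Suc (dist x)"] by simp
  qed
  let ?E = "{e \<in> S \<rightarrow>\<^sub>E UNIV. \<forall>x\<in>S. e x + e (\<sigma> x) = P}"
  define \<Psi> where "\<Psi> e = restrict (\<lambda>c. e (rep c)) (S // R)" for e :: "'a \<Rightarrow> nat"
  have E_pow: "e ((\<sigma> ^^ j) x) = (if even j then e x else P - e x)" and E_le: "e x \<le> P"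
    if e: "e \<in> ?E" and x: "x \<in> S" for e x j
  proof -
    have step: "e y + e (\<sigma> y) = P" if "y \<in> S" for y
      using e that by blast
    show "e x \<le> P"
      using step[OF x] by simp
    show "e ((\<sigma> ^^ j) x) = (if even j then e x else P - e x)"
    proof (induction j)
      case (Suc j)
      then show ?case
        using step[OF pow_S[OF x, of j]] \<open>e x \<le> P\<close> by (auto split: if_splits)
    qed simp
  qed
  have "bij_betw \<Psi> ?E (S // R \<rightarrow>\<^sub>E {..P})"
  proof (rule bij_betwI')
    fix e f assume e: "e \<in> ?E" and f: "f \<in> ?E"
    show "(\<Psi> e = \<Psi> f) = (e = f)"
    proof
      assume eq: "\<Psi> e = \<Psi> f"
      show "e = f"
      proof
        fix x
        show "e x = f x"
        proof (cases "x \<in> S")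
          case True
          let ?c = "R `` {x}"
          have c: "?c \<in> S // R"
            using True by (rule quotientI)
          have "e (rep ?c) = f (rep ?c)"
            using fun_cong[OF eq, of ?c] c by (simp add: \<Psi>_def)
          then have "e ((\<sigma> ^^ dist x) (rep ?c)) = f ((\<sigma> ^^ dist x) (rep ?c))"
            by (simp add: E_pow[OF e rep_S[OF c]] E_pow[OF f rep_S[OF c]])
          then show ?thesis
            using dist[OF True] by simp
        next
          case False
          then show ?thesis
            using e f by (auto simp: PiE_def extensional_def)
        qed
      qed
    qed simp
  next
    fix e assume "e \<in> ?E"
    then show "\<Psi> e \<in> S // R \<rightarrow>\<^sub>E {..P}"
      using E_le rep_S by (auto simp: \<Psi>_def)
  next
    fix f assume f: "f \<in> S // R \<rightarrow>\<^sub>E {..P}"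
    \<comment> \<open>Extends the values at the representatives by switching between
      \<open>v\<close> and \<open>P - v\<close> with the parity of the distance.\<close>
    define e where "e = restrict (\<lambda>x. if even (dist x) then f (R `` {x}) else P - f (R `` {x})) S"
    have f_le: "f (R `` {x}) \<le> P" if "x \<in> S" for x
      using f quotientI[OF that, of R] by auto
    have "e x + e (\<sigma> x) = P" if "x \<in> S" for x
      using that \<sigma>_S[OF that] class_\<sigma>[OF that] dist_\<sigma>[OF that] f_le[OF that] by (simp add: e_def)
    then have "e \<in> ?E"
      by (auto simp: e_def)
    moreover have "f = \<Psi> e"
    proof
      fix c
      show "f c = \<Psi> e c"
      proof (cases "c \<in> S // R")
        case True
        \<comment> \<open>The chosen distance of a representative from itself need not be 0, but it
          is even.\<close>
        have "(\<sigma> ^^ 0) (rep c) = (\<sigma> ^^ dist (rep c)) (rep c)"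
          using dist[OF rep_S[OF True]] rep_class[OF True] by simp
        then have "even (dist (rep c))"
          using parity[OF rep_S[OF True], of 0 "dist (rep c)"] by simp
        then show ?thesis
          using True rep_S[OF True] rep_class[OF True] by (simp add: \<Psi>_def e_def)
      next
        case False
        then show ?thesis
          using f by (auto simp: \<Psi>_def PiE_def extensional_def)
      qed
    qed
    ultimately show "\<exists>e\<in>?E. f = \<Psi> e"
      by blast
  qed
  then have "card ?E = card (S // R \<rightarrow>\<^sub>E {..P})"
    by (rule bij_betw_same_card)
  also have "\<dots> = (P + 1) ^ k"
    using finQ by (simp add: card_funcsetE k_def)
  finally show thesis
    using k_sum by (rule that)
qed

section \<open>Orbits of the conjugate inverse\<close>

text \<open>For odd \<open>j\<close>, \<open>q ^ j + 1\<close> is \<open>q + 1\<close> times a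
  geometric sum with ratio \<open>- q\<close>. That sum has \<open>j\<close> odd terms, so it is odd
  and does not affect powers of 2. The signs require integers.\<close>

lemma dvd_power_plus_one_odd:
  fixes q :: nat
  assumes "odd q" "odd j"
  shows "2 ^ k dvd q ^ j + 1 \<longleftrightarrow> 2 ^ k dvd q + 1"
proof -
  define s where "s = (\<Sum>m<j. (- int q) ^ m)"
  have "odd (int q)"
    using assms(1) by simp
  then have parity: "even (\<Sum>m<l. (- int q) ^ m) \<longleftrightarrow> even l" for l
    by (induction l) auto
  have "(1 - (- int q)) * s = 1 - (- int q) ^ j"
    unfolding s_def by (rule one_diff_power_eq[symmetric])
  then have eq: "(int q + 1) * s = int q ^ j + 1"
    using assms(2) by (simp add: add.commute)
  have "odd s"
    using parity[of j] assms(2) by (simp add: s_def)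
  then have "coprime (2 ^ k) s"
    by simp
  then have "(2 :: int) ^ k dvd int q ^ j + 1 \<longleftrightarrow> 2 ^ k dvd int q + 1"
    unfolding eq[symmetric] by (simp add: coprime_dvd_mult_left_iff)
  then show ?thesis
    by (metis (mono_tags) of_nat_dvd_iff of_nat_power of_nat_add of_nat_1 of_nat_numeral)
qed

lemma funpow_inverse_power:
  fixes x :: "'a::field"
  shows "((\<lambda>b. inverse b ^ q) ^^ j) x = (if even j then x ^ (q ^ j) else inverse x ^ (q ^ j))"
  by (induction j) (auto simp: power_inverse mult.commute simp flip: power_mult)

lemma has_mult_order_power_eq_self_iff:
  fixes x :: "'a::field"
  assumes "has_mult_order x N" "x \<noteq> 0" "k > 0"
  shows "x ^ k = x \<longleftrightarrow> [k = 1] (mod N)"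
proof -
  have "x ^ k = x * x ^ (k - 1)"
    using assms(3) by (simp flip: power_Suc)
  then have "x ^ k = x \<longleftrightarrow> x ^ (k - 1) = 1"
    using assms(2) by simp
  also have "\<dots> \<longleftrightarrow> N dvd k - 1"
    by (rule has_mult_order_power[OF assms(1)])
  also have "\<dots> \<longleftrightarrow> [k = 1] (mod N)"
    using assms(3) by (simp add: cong_altdef_nat cong_sym_eq[of 1])
  finally show ?thesis .
qed

text \<open>No odd return time \<open>j\<close> occurs: it would give \<open>N dvd q ^ j + 1\<close>, hence \<open>2 ^ k dvd q + 1\<close>.\<close>
lemma conj_orbit_period:
  fixes x :: "'a::field"
  assumes x: "has_mult_order x N" "x \<noteq> 0" and q: "odd q"
    and N: "2 ^ k dvd N" "\<not> 2 ^ k dvd q + 1"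
  shows "((\<lambda>b. inverse b ^ q) ^^ j) x = x \<longleftrightarrow> 2 * ord N (q ^ 2) dvd j"
proof (cases "even j")
  case True
  then obtain i where i: "j = 2 * i"
    by (elim evenE)
  have "((\<lambda>b. inverse b ^ q) ^^ j) x = x \<longleftrightarrow> x ^ (q ^ j) = x"
    using True by (simp add: funpow_inverse_power)
  also have "\<dots> \<longleftrightarrow> [(q ^ 2) ^ i = 1] (mod N)"
    using has_mult_order_power_eq_self_iff[OF x, of "q ^ j"] odd_pos[OF q] by (simp add: i power_mult)
  also have "\<dots> \<longleftrightarrow> ord N (q ^ 2) dvd i"
    by (rule ord_divides)
  finally show ?thesis
    by (simp add: i)
next
  case False
  have "inverse x ^ (q ^ j) = x \<longleftrightarrow> x ^ (q ^ j + 1) = 1"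
    using x(2) by (auto simp: field_simps)
  also have "\<dots> \<longleftrightarrow> N dvd q ^ j + 1"
    by (rule has_mult_order_power[OF x(1)])
  finally have "inverse x ^ (q ^ j) = x \<Longrightarrow> 2 ^ k dvd q ^ j + 1"
    using N(1) dvd_trans by blast
  then have "((\<lambda>b. inverse b ^ q) ^^ j) x \<noteq> x"
    using dvd_power_plus_one_odd[OF q False] N(2) False by (auto simp: funpow_inverse_power)
  moreover have "\<not> 2 * ord N (q ^ 2) dvd j"
    using False by auto
  ultimately show ?thesis
    by simp
qed

section \<open>Roots of -1 sorted by multiplicative order\<close>

text \<open>With \<open>m = 2 ^ \<nu> * n'\<close>, the order divides \<open>2 * m\<close> but has
  one factor 2 too many to divide \<open>m\<close>; so \<open>x ^ m\<close> squares to 1 without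
  being 1.\<close>

lemma roots_of_minus_one_order:
  fixes x :: "'a::field"
  assumes two: "(2 :: 'a) \<noteq> 0" and n': "odd n'" and d: "d dvd n'" and x: "has_mult_order x (d * 2 ^ (\<nu> + 1))"
  shows "x ^ (2 ^ \<nu> * n') = - 1"
proof -
  have "(x ^ (2 ^ \<nu> * n')) ^ 2 = x ^ (n' * 2 ^ (\<nu> + 1))"
    by (simp add: mult_ac flip: power_mult)
  also have "\<dots> = 1"
    using d by (simp add: has_mult_order_power[OF x] mult_dvd_mono)
  finally have "x ^ (2 ^ \<nu> * n') = 1 \<or> x ^ (2 ^ \<nu> * n') = - 1"
    by (simp add: power2_eq_1_iff)
  moreover have "\<not> d * 2 ^ (\<nu> + 1) dvd 2 ^ \<nu> * n'"
  proof
    assume "d * 2 ^ (\<nu> + 1) dvd 2 ^ \<nu> * n'"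
    then have "2 ^ \<nu> * 2 dvd 2 ^ \<nu> * n'"
      by (auto intro: dvd_trans[OF _ \<open>d * 2 ^ (\<nu> + 1) dvd 2 ^ \<nu> * n'\<close>])
    then show False
      using n' by simp
  qed
  then have "x ^ (2 ^ \<nu> * n') \<noteq> 1"
    by (simp add: has_mult_order_power[OF x])
  ultimately show ?thesis
    by simp
qed

lemma roots_of_minus_one_eq_Union:
  assumes two: "(2 :: 'a::field) \<noteq> 0" and n': "odd n'"
  shows "{x :: 'a. x ^ (2 ^ \<nu> * n') = - 1} =
    (\<Union>d\<in>{d. d dvd n'}. {x. has_mult_order x (d * 2 ^ (\<nu> + 1))})"
proof (intro equalityI subsetI)
  fix x :: 'a assume "x \<in> {x. x ^ (2 ^ \<nu> * n') = - 1}"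
  then have x: "x ^ (2 ^ \<nu> * n') = - 1"
    by simp
  have n'_pos: "n' > 0"
    using n' by (rule odd_pos)
  have "x ^ (n' * 2 ^ (\<nu> + 1)) = (x ^ (2 ^ \<nu> * n')) ^ 2"
    by (simp add: mult_ac flip: power_mult)
  also have "\<dots> = 1"
    by (simp add: x)
  finally obtain N where N: "has_mult_order x N" "N dvd n' * 2 ^ (\<nu> + 1)"
    using has_mult_order_exists[of x "n' * 2 ^ (\<nu> + 1)"] n'_pos by auto
  obtain d e where de: "N = d * e" "d dvd n'" "e dvd 2 ^ (\<nu> + 1)"
    using division_decomp[OF N(2)] by auto
  obtain i where i: "i \<le> \<nu> + 1" "e = 2 ^ i"
    using de(3) divides_primepow_nat[OF two_is_prime_nat, of e "\<nu> + 1"] by blast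
  \<comment> \<open>A smaller power of 2 would make the order divide \<open>2 ^ \<nu> * n'\<close>,
    forcing \<open>- 1 = 1\<close>.\<close>
  have "i = \<nu> + 1"
  proof (rule ccontr)
    assume "i \<noteq> \<nu> + 1"
    then have "e dvd 2 ^ \<nu>"
      using i by (simp add: le_imp_power_dvd)
    then have "N dvd 2 ^ \<nu> * n'"
      unfolding de(1) using de(2) by (subst mult.commute) (rule mult_dvd_mono)
    then have "- 1 = (1 :: 'a)"
      using has_mult_order_power[OF N(1)] x by metis
    then have "(2 :: 'a) = 0"
      by (metis add_neg_numeral_special(7) one_add_one)
    then show False
      using two by simp
  qed
  then show "x \<in> (\<Union>d\<in>{d. d dvd n'}. {x. has_mult_order x (d * 2 ^ (\<nu> + 1))})"
    using N(1) de i by auto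
qed (use roots_of_minus_one_order[OF two n'] in auto)

section \<open>Assembly of the count\<close>

theorem theorem3p15:
  fixes p r l \<nu> n' n :: nat
  assumes "prime p" and "odd p"
    and "\<nu> > 0" and "odd n'" and "n' > 0" and "\<not> p dvd n'"
    and "n = 2 ^ \<nu> * p ^ r * n'"
    and "l > 0"
    and "card (UNIV :: 'a::{field,finite} set) = p ^ (2 * l)"
  shows "real (NH TYPE('a) (p ^ l) n) =
    (if \<not> (2 ^ (\<nu> + 1) dvd p ^ l + 1) then
       (real (p ^ r) + 1) powr
         ((\<Sum>d | d dvd n'. real (totient (d * 2 ^ (\<nu> + 1))) /
                            real (ord (d * 2 ^ (\<nu> + 1)) (p ^ (2 * l)))) / 2)
     else 0)"
proof -
  define q where "q = p ^ l"
  define P where "P = p ^ r"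
  define m where "m = 2 ^ \<nu> * n'"
  define S where "S = {a :: 'a alg_closure. a ^ m = - 1}"
  define E where "E = {e \<in> S \<rightarrow>\<^sub>E UNIV. \<forall>b\<in>S. e b + e (inverse b ^ q) = P}"
  have q: "odd q" "q > 0" and P: "odd P" and Q: "p ^ (2 * l) = q ^ 2"
    using \<open>odd p\<close> by (auto simp: q_def P_def odd_pos power_mult mult.commute[of 2] intro: Nat.gr0I)
  have m: "m > 0" and n: "n > 0" "n = m * P"
    using assms(1,5,7) prime_gt_0_nat[of p] by (auto simp: m_def P_def)
  have "CHAR('a) dvd p ^ (2 * l)"
    using CHAR_dvd_CARD[where ?'a = 'a] assms(9) by simp
  moreover have "prime CHAR('a)"
    using CHAR_dvd_CARD[where ?'a = 'a] assms(9) prime_gt_0_nat[OF assms(1)]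
    by (intro prime_CHAR_semidom) (auto intro!: Nat.gr0I)
  ultimately have char: "CHAR('a) = p"
    using assms(1) by (metis prime_dvd_power primes_dvd_imp_eq)
  have of_nat_nz: "of_nat k \<noteq> (0 :: 'a alg_closure)" if "\<not> p dvd k" for k
    using that by (simp add: of_nat_eq_0_iff_char_dvd char)
  have p_two: "\<not> p dvd 2 ^ k" for k
    using assms(1,2) by (metis prime_dvd_power primes_dvd_imp_eq two_is_prime_nat even_numeral)
  have two: "(2 :: 'a alg_closure) \<noteq> 0"
    using of_nat_nz[of 2] p_two[of 1] by simp
  have p_m: "\<not> p dvd m"
    using assms(1,6) p_two by (simp add: m_def prime_dvd_mult_iff)
  have F: "field_hom (\<lambda>x::'a. x ^ q)"
    using field_hom_frobenius[where ?'a = 'a and k = l] assms(1) by (simp add: char q_def)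
  have K: "field_hom (\<lambda>x::'a alg_closure. x ^ q)"
    using field_hom_frobenius[where ?'a = "'a alg_closure" and k = l] assms(1) by (simp add: char q_def)
  have M: "order a (monom 1 n + 1) = (if a \<in> S then P else 0)" for a :: "'a alg_closure"
    using order_negacyclic_modulus[of m a r] of_nat_nz[OF p_m] assms(1)
    by (simp add: char n(2) P_def S_def)
  have NH: "NH TYPE('a) q n = card E"
    unfolding NH_eq_card_generators[OF F n(1)] E_def S_def
    by (rule card_generators_eq_card_exponents[OF F K])
      (use assms(9) Q q m n M in \<open>simp_all add: S_def\<close>)
  have S_Union: "S = (\<Union>d\<in>{d. d dvd n'}. {x. has_mult_order x (d * 2 ^ (\<nu> + 1))})"
    unfolding S_def m_def by (rule roots_of_minus_one_eq_Union[OF two assms(4)])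
  have nz_order: "of_nat (d * 2 ^ (\<nu> + 1)) \<noteq> (0 :: 'a alg_closure)"
    and coprime_order: "coprime (d * 2 ^ (\<nu> + 1)) (q ^ 2)" if "d dvd n'" for d
  proof -
    have "\<not> p dvd d"
      using that assms(6) dvd_trans by blast
    then have *: "\<not> p dvd d * 2 ^ (\<nu> + 1)"
      using assms(1) p_two by (simp add: prime_dvd_mult_iff del: power_Suc)
    then show "of_nat (d * 2 ^ (\<nu> + 1)) \<noteq> (0 :: 'a alg_closure)"
      by (rule of_nat_nz)
    show "coprime (d * 2 ^ (\<nu> + 1)) (q ^ 2)"
      using prime_imp_coprime[OF assms(1) *] by (simp add: q_def coprime_commute)
  qed
  show ?thesis
  proof (cases "2 ^ (\<nu> + 1) dvd q + 1")
    case True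
    \<comment> \<open>The divisor 1 of \<open>n'\<close> supplies a root of order
      \<open>2 ^ (\<nu> + 1)\<close>. As this divides \<open>q + 1\<close>, the root is a fixed
      point of \<open>b \<mapsto> inverse b ^ q\<close>.\<close>
    have "card {x :: 'a alg_closure. has_mult_order x (1 * 2 ^ (\<nu> + 1))} > 0"
      using card_has_mult_order[OF nz_order[of 1]] by (simp del: power_Suc)
    then obtain x :: "'a alg_closure" where x: "has_mult_order x (1 * 2 ^ (\<nu> + 1))"
      by (metis (mono_tags, lifting) Collect_empty_eq card.empty less_irrefl)
    then have "x \<in> S"
      unfolding S_Union by (intro UN_I[of 1]) simp_all
    then have "x \<noteq> 0"
      using m by (auto simp: S_def power_0_left)
    have "x ^ (q + 1) = 1"
      using has_mult_order_power[OF x, of "q + 1"] True by simp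
    then have fixed: "inverse x ^ q = x"
      using \<open>x \<noteq> 0\<close> by (auto simp: field_simps)
    \<comment> \<open>At a fixed point the equation would write the odd number \<open>P\<close> as
      \<open>e x + e x\<close>.\<close>
    have "E = {}"
    proof (intro equals0I)
      fix e assume "e \<in> E"
      then have "e x + e (inverse x ^ q) = P"
        using \<open>x \<in> S\<close> by (simp add: E_def)
      then show False
        using fixed P by (metis even_add)
    qed
    then show ?thesis
      using True NH by (simp add: q_def)
  next
    case False
    define N where "N x = (THE N. has_mult_order x N)" for x :: "'a alg_closure"
    have N: "N x = e" if "has_mult_order x e" for x e
      unfolding N_def using that has_mult_order_unique by (intro the_equality) auto
    define t where "t x = 2 * ord (N x) (q ^ 2)" for x
    have S_cases: "\<exists>d. d dvd n' \<and> has_mult_order x (d * 2 ^ (\<nu> + 1)) \<and> N x = d * 2 ^ (\<nu> + 1)"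
      if "x \<in> S" for x
    proof -
      from that obtain d where "d dvd n'" "has_mult_order x (d * 2 ^ (\<nu> + 1))"
        unfolding S_Union by (elim UN_E) simp
      then show ?thesis
        using N by (intro exI[of _ d] conjI)
    qed
    have finS: "finite S"
      unfolding S_def by (rule finite_roots_of[OF m])
    obtain k where k: "card {e \<in> S \<rightarrow>\<^sub>E UNIV. \<forall>x\<in>S. e x + e (inverse x ^ q) = P} = (P + 1) ^ k"
      "real k = (\<Sum>x\<in>S. 1 / real (t x))"
    proof (rule card_alternating_functions[OF finS, of "\<lambda>b. inverse b ^ q" t P])
      fix x assume x: "x \<in> S"
      then have x_nz: "x \<noteq> 0"
        using m by (auto simp: S_def power_0_left)
      obtain d where d: "d dvd n'" "has_mult_order x (d * 2 ^ (\<nu> + 1))" "N x = d * 2 ^ (\<nu> + 1)"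
        using S_cases[OF x] by blast
      show "((\<lambda>b. inverse b ^ q) ^^ j) x = x \<longleftrightarrow> t x dvd j" for j
        unfolding t_def d(3) by (rule conj_orbit_period[OF d(2) x_nz q(1) _ False]) simp
      \<comment> \<open>\<open>ord\<close> takes the value 0 on arguments that are not coprime, so
        positivity rests on the order of \<open>x\<close> being prime to \<open>p\<close>.\<close>
      show "t x > 0"
        using coprime_order[OF d(1)] by (simp add: t_def d(3) del: power_Suc)
      show "even (t x)"
        by (simp add: t_def)
      have "(inverse x ^ q) ^ m = inverse (x ^ m) ^ q"
        by (simp add: power_inverse mult.commute flip: power_mult)
      then show "inverse x ^ q \<in> S"
        using x q by (simp add: S_def)
    qed
    \<comment> \<open>The orbit length depends only on the order of the root, so the roots are
      grouped by order; the \<open>totient\<close> many of one order share a summand.\<close>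
    have "real k = (\<Sum>d | d dvd n'. \<Sum>x | has_mult_order x (d * 2 ^ (\<nu> + 1)). 1 / real (t x))"
      unfolding k(2) S_Union
    proof (rule sum.UNION_disjoint)
      show "finite {d. d dvd n'}"
        using assms(5) by simp
      show "\<forall>d\<in>{d. d dvd n'}. finite {x :: 'a alg_closure. has_mult_order x (d * 2 ^ (\<nu> + 1))}"
      proof
        fix d assume "d \<in> {d. d dvd n'}"
        then have "d > 0"
          using assms(5) by (auto intro: dvd_pos_nat)
        then show "finite {x :: 'a alg_closure. has_mult_order x (d * 2 ^ (\<nu> + 1))}"
          by (intro finite_has_mult_order) simp
      qed
      show "\<forall>d\<in>{d. d dvd n'}. \<forall>e\<in>{d. d dvd n'}. d \<noteq> e \<longrightarrow>
          {x :: 'a alg_closure. has_mult_order x (d * 2 ^ (\<nu> + 1))} \<inter> {x. has_mult_order x (e * 2 ^ (\<nu> + 1))} = {}"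
      proof (intro ballI impI equals0I)
        fix d e x
        assume "d \<noteq> e" and "x \<in> {x :: 'a alg_closure. has_mult_order x (d * 2 ^ (\<nu> + 1))} \<inter>
          {x. has_mult_order x (e * 2 ^ (\<nu> + 1))}"
        then show False
          using has_mult_order_unique[of x "d * 2 ^ (\<nu> + 1)" "e * 2 ^ (\<nu> + 1)"] by simp
      qed
    qed
    also have "\<dots> = (\<Sum>d | d dvd n'. real (totient (d * 2 ^ (\<nu> + 1))) /
        real (ord (d * 2 ^ (\<nu> + 1)) (p ^ (2 * l))) / 2)"
    proof (rule sum.cong[OF refl])
      fix d assume "d \<in> {d. d dvd n'}"
      then have d: "d dvd n'"
        by simp
      have "(\<Sum>x :: 'a alg_closure | has_mult_order x (d * 2 ^ (\<nu> + 1)). 1 / real (t x)) =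
          (\<Sum>x :: 'a alg_closure | has_mult_order x (d * 2 ^ (\<nu> + 1)).
            1 / real (2 * ord (d * 2 ^ (\<nu> + 1)) (q ^ 2)))"
        by (rule sum.cong[OF refl]) (simp add: t_def N)
      also have "\<dots> = real (totient (d * 2 ^ (\<nu> + 1))) *
          (1 / real (2 * ord (d * 2 ^ (\<nu> + 1)) (q ^ 2)))"
        unfolding sum_constant card_has_mult_order[OF nz_order[OF d]] ..
      finally show "(\<Sum>x :: 'a alg_closure | has_mult_order x (d * 2 ^ (\<nu> + 1)). 1 / real (t x)) =
          real (totient (d * 2 ^ (\<nu> + 1))) / real (ord (d * 2 ^ (\<nu> + 1)) (p ^ (2 * l))) / 2"
        by (simp add: Q)
    qed
    also have "\<dots> = (\<Sum>d | d dvd n'. real (totient (d * 2 ^ (\<nu> + 1))) /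
        real (ord (d * 2 ^ (\<nu> + 1)) (p ^ (2 * l)))) / 2"
      by (rule sum_divide_distrib[symmetric])
    finally have exponent: "real k = \<dots>" .
    \<comment> \<open>Although written with real quotients, the exponent counts orbits, so it is the
      natural number \<open>k\<close> and \<open>powr\<close> agrees with the ordinary
      power.\<close>
    have "real (NH TYPE('a) (p ^ l) n) = (real P + 1) ^ k"
      using NH k(1) by (simp add: E_def q_def[symmetric] add.commute)
    also have "\<dots> = (real P + 1) powr real k"
      by (simp add: powr_realpow)
    finally show ?thesis
      using False by (simp only: exponent P_def q_def if_True not_False_eq_True)
  qed
qed

end
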